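(* Let $n\ge 2$ and $2\le d\le n$ be integers and let $k$ be an integer with $1\le k\le n(n-d+2)/2$ if $n-d$ is even and $1\le k\le (n+1)(n-d+1)/2$ if $n-d$ is odd. Then $$\delta_q^{\mathrm{Sym}}(n \times n, k, d) \in O\left(q^{n(n+1)/2-k+1-n(d-1)+(d-1)(d-2)/2}\right) \quad \text{as } q \to +\infty.$$ Moreover, $\lim_{q \to+\infty}\delta^{\mathrm{Sym}}_q(n \times n,k,d)=1$ if $k < \frac{n(n+1)}{2}+1-n(d-1)+\frac{(d-1)(d-2)}{2}$, and $=0$ if $k > \frac{n(n+1)}{2}+1-n(d-1)+\frac{(d-1)(d-2)}{2}$. In particular, $\delta_q^{\mathrm{Sym}}(n \times n, n, n) \in O(q^{-n+2})$ as $q \to +\infty$.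
   Context: $\mathrm{Sym}_n(q)$ is the $\mathbb{F}_q$-space (of dimension $n(n+1)/2$) of symmetric $n\times n$ matrices over $\mathbb{F}_q$. $\delta^{\mathrm{Sym}}_q(n\times n,k,d)$ is the number of $k$-dimensional $\mathbb{F}_q$-subspaces of $\mathrm{Sym}_n(q)$ in which every nonzero matrix has rank at least $d$, divided by the number of all $k$-dimensional subspaces of $\mathrm{Sym}_n(q)$. Limits are over prime powers $q$ with $n,k,d$ fixed. *)

theory Defs
  imports
    "Jordan_Normal_Form.Missing_VectorSpace"
    "HOL-Number_Theory.Prime_Powers"
    "HOL-Library.Landau_Symbols"
begin

text \<open>
  The field with \<open>q\<close> elements varies with \<open>q\<close> inside a limit, so it cannot be a type; fields are
  records \<open>R\<close> with an explicit carrier. An \<open>n\<close>-by-\<open>n\<close> matrix over \<open>R\<close> is an extensional function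
  on \<open>{..<n} \<times> {..<n}\<close> with values in \<open>carrier R\<close>.
\<close>

abbreviation column_space :: "'a ring \<Rightarrow> nat \<Rightarrow> ('a, nat \<Rightarrow> 'a) module" where
  "column_space R n \<equiv> ring.func_space R {..<n}"

abbreviation matrix_space :: "'a ring \<Rightarrow> nat \<Rightarrow> ('a, nat \<times> nat \<Rightarrow> 'a) module" where
  "matrix_space R n \<equiv> ring.func_space R ({..<n} \<times> {..<n})"

definition sym_space :: "'a ring \<Rightarrow> nat \<Rightarrow> ('a, nat \<times> nat \<Rightarrow> 'a) module" where
  "sym_space R n = (matrix_space R n)
     \<lparr>carrier := {A \<in> carrier (matrix_space R n). \<forall>i<n. \<forall>j<n. A (i, j) = A (j, i)}\<rparr>"

definition column :: "nat \<Rightarrow> (nat \<times> nat \<Rightarrow> 'a) \<Rightarrow> nat \<Rightarrow> (nat \<Rightarrow> 'a)" where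
  "column n A j = (\<lambda>i\<in>{..<n}. A (i, j))"

definition matrix_rank :: "'a ring \<Rightarrow> nat \<Rightarrow> (nat \<times> nat \<Rightarrow> 'a) \<Rightarrow> nat" where
  "matrix_rank R n A = vectorspace.dim R ((column_space R n)
     \<lparr>carrier := LinearCombinations.module.span R (column_space R n) (column n A ` {..<n})\<rparr>)"

definition subspaces_of_dim :: "'a ring \<Rightarrow> ('a, 'v) module \<Rightarrow> nat \<Rightarrow> 'v set set" where
  "subspaces_of_dim R V k =
     {W. VectorSpace.subspace R W V \<and> vectorspace.dim R (V\<lparr>carrier := W\<rparr>) = k}"

definition sym_density :: "'a ring \<Rightarrow> nat \<Rightarrow> nat \<Rightarrow> nat \<Rightarrow> real" where
  "sym_density R n k d =
     real (card {W \<in> subspaces_of_dim R (sym_space R n) k.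
                   \<forall>A\<in>W. A \<noteq> \<zero>\<^bsub>sym_space R n\<^esub> \<longrightarrow> d \<le> matrix_rank R n A})
     / real (card (subspaces_of_dim R (sym_space R n) k))"

definition at_top_primepow :: "nat filter" where
  "at_top_primepow = inf at_top (principal {q. primepow q})"

lemma sym_space_is_vectorspace:
  assumes "field R"
  shows "vectorspace R (sym_space R n)"
proof -
  interpret R: field R by fact
  have m: "Module.module R (matrix_space R n)"
    by (rule R.func_space_is_module)
  interpret M: vectorspace R "matrix_space R n"
    by (rule vectorspace.intro[OF m assms])
  let ?S = "{A \<in> carrier (matrix_space R n). \<forall>i<n. \<forall>j<n. A (i, j) = A (j, i)}"
  have "LinearCombinations.submodule R ?S (matrix_space R n)"
    by (rule LinearCombinations.submodule.intro[OF m]) (auto simp: R.func_space_def)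
  then have "VectorSpace.subspace R ?S (matrix_space R n)"
    using M.vectorspace_axioms by (rule VectorSpace.subspace.intro[rotated])
  then show ?thesis
    unfolding sym_space_def by (rule M.subspace_is_vs)
qed

end

theory Submission
  imports Defs
begin

text \<open>
  Choose a \<open>k\<close>-dimensional subspace of the \<open>N\<close>-dimensional space of symmetric matrices uniformly at
  random and count the nonzero matrices of rank at most \<open>d - 1\<close> in it. A fixed nonzero matrix is
  contained with probability \<open>(q\<^sup>k - 1) / (q\<^sup>N - 1)\<close>, so if there are \<open>b\<close> such matrices, the expected
  number of lines spanned by them is about \<open>b q\<^bsup>k-N-1\<^esup>\<close>. The union bound over these lines gives the
  limit \<open>1\<close>; Chebyshev's inequality gives the upper bound \<open>O(q\<^bsup>N-k+1\<^esup> / b)\<close> and hence the limit \<open>0\<close>.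
  It remains to see that \<open>b\<close> has order \<open>q\<^sup>m\<close> with \<open>m = n (d - 1) - (d - 1) (d - 2) / 2\<close>. A symmetric
  matrix of rank at most \<open>r = d - 1\<close> is determined by some \<open>r\<close> of its rows, that is, by at most \<open>m\<close>
  entries, which bounds \<open>b\<close> from above; an injective \<open>LDL\<^sup>T\<close> parametrisation by \<open>m\<close> scalars, \<open>r\<close> of
  which are nonzero, bounds \<open>b\<close> from below.
\<close>

section \<open>Counting subspaces of a finite vector space\<close>

text \<open>Coordinates in a finite basis identify the vectors with the functions from that basis to
  the scalars. This lets cardinalities, which suit double counting, stand in for dimensions.\<close>

lemma (in vectorspace) card_carrier_eq_power_dim:
  assumes "finite (carrier V)"
  shows "card (carrier V) = card (carrier K) ^ dim"
proof -
  have "fin_dim"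
    unfolding fin_dim_def using assms in_own_span[of "carrier V"] span_is_subset2[of "carrier V"]
    by (intro exI[of _ "carrier V"]) auto
  then obtain \<beta> where \<beta>: "finite \<beta>" "basis \<beta>"
    using finite_basis_exists by auto
  then have sub: "\<beta> \<subseteq> carrier V"
    by (simp add: basis_def)
  have ex1: "\<exists>!a. a \<in> \<beta> \<rightarrow>\<^sub>E carrier K \<and> lincomb a \<beta> = v" if "v \<in> carrier V" for v
    using basis_criterion[OF \<beta>(1) sub] \<beta>(2) that by blast
  have cl: "lincomb a \<beta> \<in> carrier V" if "a \<in> \<beta> \<rightarrow>\<^sub>E carrier K" for a
    using that sub by (intro lincomb_closed) auto
  have "bij_betw (\<lambda>a. lincomb a \<beta>) (\<beta> \<rightarrow>\<^sub>E carrier K) (carrier V)"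
    unfolding bij_betw_def
  proof
    show "inj_on (\<lambda>a. lincomb a \<beta>) (\<beta> \<rightarrow>\<^sub>E carrier K)"
      by (rule inj_onI) (metis ex1 cl)
    show "(\<lambda>a. lincomb a \<beta>) ` (\<beta> \<rightarrow>\<^sub>E carrier K) = carrier V"
      using cl ex1 by blast
  qed
  then show ?thesis
    using bij_betw_same_card card_funcsetE[OF \<beta>(1)] dim_basis[OF \<beta>] by metis
qed

text \<open>A Gaussian binomial coefficient in terms of sizes: for a subspace of size
  \<open>u\<close> in a space of size \<open>Q\<close>, the number of \<open>m\<close>-dimensional
  subspaces of the quotient, which has \<open>Q / u\<close> elements.\<close>

definition superspace_count :: "real \<Rightarrow> real \<Rightarrow> real \<Rightarrow> nat \<Rightarrow> real" where
  "superspace_count Q q u m = (\<Prod>i<m. (Q - q ^ i * u) / ((q ^ m - q ^ i) * u))"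

lemma superspace_count_0 [simp]: "superspace_count Q q u 0 = 1"
  by (simp add: superspace_count_def)

text \<open>Splitting off the factor at \<open>i = 0\<close> and absorbing one \<open>q\<close> of
  each remaining factor into \<open>u\<close> gives the same product for \<open>q * u\<close>, the
  size after one vector has been adjoined.\<close>

lemma superspace_count_Suc:
  "superspace_count Q q u (Suc m) =
     (Q - u) / ((q ^ Suc m - 1) * u) * superspace_count Q q (q * u) m"
proof -
  have "(q ^ Suc m - q ^ Suc i) * u = (q ^ m - q ^ i) * (q * u)" for i
    by (simp add: algebra_simps)
  moreover have "q ^ Suc i * u = q ^ i * (q * u)" for i
    by (simp add: algebra_simps)
  ultimately show ?thesis
    unfolding superspace_count_def by (simp only: prod.lessThan_Suc_shift) simp
qed

locale finite_vectorspace = vectorspace +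
  assumes finite_scalars: "finite (carrier K)"
    and finite_vectors: "finite (carrier V)"
begin

text \<open>For a subspace \<open>U\<close> this is the span of \<open>U\<close> and
  \<open>v\<close>, parametrised so that its size becomes a question of injectivity.\<close>

definition adjoin :: "'c set \<Rightarrow> 'c \<Rightarrow> 'c set" where
  "adjoin U v = (\<lambda>(a, u). a \<odot>\<^bsub>V\<^esub> v \<oplus>\<^bsub>V\<^esub> u) ` (carrier K \<times> U)"

text \<open>The number \<open>m\<close> is the codimension of \<open>U\<close> in \<open>W\<close>,
  encoded by cardinality. With \<open>U\<close> the zero space these are the
  \<open>m\<close>-dimensional subspaces.\<close>

definition superspaces :: "'c set \<Rightarrow> nat \<Rightarrow> 'c set set" where
  "superspaces U m = {W. VectorSpace.subspace K W V \<and> U \<subseteq> W \<and> card W = card (carrier K) ^ m * card U}"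

lemma card_scalars_ge_2: "2 \<le> card (carrier K)"
proof -
  have "card {\<zero>\<^bsub>K\<^esub>, \<one>\<^bsub>K\<^esub>} \<le> card (carrier K)"
    by (intro card_mono finite_scalars) auto
  then show ?thesis by simp
qed

lemma subspaceD:
  assumes "VectorSpace.subspace K U V"
  shows "U \<subseteq> carrier V" "\<zero>\<^bsub>V\<^esub> \<in> U" "finite U" "card U > 0"
    and "\<And>v w. v \<in> U \<Longrightarrow> w \<in> U \<Longrightarrow> v \<oplus>\<^bsub>V\<^esub> w \<in> U"
    and "\<And>c v. c \<in> carrier K \<Longrightarrow> v \<in> U \<Longrightarrow> c \<odot>\<^bsub>V\<^esub> v \<in> U"
proof -
  interpret LinearCombinations.submodule K U V using assms by simp
  show "U \<subseteq> carrier V" "\<zero>\<^bsub>V\<^esub> \<in> U"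
    using subset by auto
  then show "finite U" using finite_vectors finite_subset by blast
  then show "card U > 0" using \<open>\<zero>\<^bsub>V\<^esub> \<in> U\<close> card_gt_0_iff by blast
qed (use assms in \<open>auto simp: VectorSpace.subspace_def LinearCombinations.submodule_def\<close>)

lemma subspaceI:
  assumes "U \<subseteq> carrier V" "\<zero>\<^bsub>V\<^esub> \<in> U"
    and "\<And>v w. v \<in> U \<Longrightarrow> w \<in> U \<Longrightarrow> v \<oplus>\<^bsub>V\<^esub> w \<in> U"
    and "\<And>c v. c \<in> carrier K \<Longrightarrow> v \<in> U \<Longrightarrow> c \<odot>\<^bsub>V\<^esub> v \<in> U"
  shows "VectorSpace.subspace K U V"
  using assms vectorspace_axioms module_axioms
  by (auto simp: VectorSpace.subspace_def LinearCombinations.submodule_def)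

lemma zero_subspace: "VectorSpace.subspace K {\<zero>\<^bsub>V\<^esub>} V"
  by (rule subspaceI) auto

lemma subspace_adjoin:
  assumes U: "VectorSpace.subspace K U V" and v: "v \<in> carrier V"
  shows "VectorSpace.subspace K (adjoin U v) V"
proof (rule subspaceI)
  note U = subspaceD[OF U]
  show "adjoin U v \<subseteq> carrier V"
    using U v by (auto simp: adjoin_def)
  show "\<zero>\<^bsub>V\<^esub> \<in> adjoin U v"
    unfolding adjoin_def using U v
    by (intro rev_image_eqI[of "(\<zero>\<^bsub>K\<^esub>, \<zero>\<^bsub>V\<^esub>)"]) auto
next
  note U = subspaceD[OF U]
  fix x y assume "x \<in> adjoin U v" "y \<in> adjoin U v"
  then obtain a u b w where *: "a \<in> carrier K" "u \<in> U" "x = a \<odot>\<^bsub>V\<^esub> v \<oplus>\<^bsub>V\<^esub> u"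
    "b \<in> carrier K" "w \<in> U" "y = b \<odot>\<^bsub>V\<^esub> v \<oplus>\<^bsub>V\<^esub> w"
    by (auto simp: adjoin_def)
  moreover from this have "u \<in> carrier V" "w \<in> carrier V" using U by auto
  ultimately have "x \<oplus>\<^bsub>V\<^esub> y = (a \<oplus>\<^bsub>K\<^esub> b) \<odot>\<^bsub>V\<^esub> v \<oplus>\<^bsub>V\<^esub> (u \<oplus>\<^bsub>V\<^esub> w)"
    using v by (simp add: smult_l_distr M.a_ac)
  then show "x \<oplus>\<^bsub>V\<^esub> y \<in> adjoin U v"
    unfolding adjoin_def using U *
    by (intro rev_image_eqI[of "(a \<oplus>\<^bsub>K\<^esub> b, u \<oplus>\<^bsub>V\<^esub> w)"]) auto
next
  note U = subspaceD[OF U]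
  fix c x assume c: "c \<in> carrier K" and "x \<in> adjoin U v"
  then obtain a u where *: "a \<in> carrier K" "u \<in> U" "x = a \<odot>\<^bsub>V\<^esub> v \<oplus>\<^bsub>V\<^esub> u"
    by (auto simp: adjoin_def)
  then have "c \<odot>\<^bsub>V\<^esub> x = (c \<otimes>\<^bsub>K\<^esub> a) \<odot>\<^bsub>V\<^esub> v \<oplus>\<^bsub>V\<^esub> (c \<odot>\<^bsub>V\<^esub> u)"
    using U v c by (auto simp: smult_assoc1 smult_r_distr)
  then show "c \<odot>\<^bsub>V\<^esub> x \<in> adjoin U v"
    unfolding adjoin_def using U * c
    by (intro rev_image_eqI[of "(c \<otimes>\<^bsub>K\<^esub> a, c \<odot>\<^bsub>V\<^esub> u)"]) auto
qed

lemma subset_adjoin: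
  assumes U: "VectorSpace.subspace K U V" and v: "v \<in> carrier V"
  shows "U \<subseteq> adjoin U v"
proof
  note U = subspaceD[OF U]
  fix u assume "u \<in> U"
  then show "u \<in> adjoin U v"
    unfolding adjoin_def using U v
    by (intro rev_image_eqI[of "(\<zero>\<^bsub>K\<^esub>, u)"]) auto
qed

lemma mem_adjoin:
  assumes U: "VectorSpace.subspace K U V" and v: "v \<in> carrier V"
  shows "v \<in> adjoin U v"
  unfolding adjoin_def using subspaceD[OF U] v
  by (intro rev_image_eqI[of "(\<one>\<^bsub>K\<^esub>, \<zero>\<^bsub>V\<^esub>)"]) auto

lemma adjoin_subset:
  assumes "VectorSpace.subspace K W V" "U \<subseteq> W" "v \<in> W"
  shows "adjoin U v \<subseteq> W"
  using subspaceD[OF assms(1)] assms(2,3) by (auto simp: adjoin_def)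

text \<open>Two representations of the same vector with different scalars would put a nonzero
  multiple of \<open>v\<close>, and hence \<open>v\<close>, into \<open>U\<close>.\<close>

lemma card_adjoin:
  assumes U: "VectorSpace.subspace K U V" and v: "v \<in> carrier V" "v \<notin> U"
  shows "card (adjoin U v) = card (carrier K) * card U"
proof -
  note UD = subspaceD[OF U]
  have "inj_on (\<lambda>(a, u). a \<odot>\<^bsub>V\<^esub> v \<oplus>\<^bsub>V\<^esub> u) (carrier K \<times> U)"
  proof (rule inj_onI, clarsimp)
    fix a u b w assume a: "a \<in> carrier K" and b: "b \<in> carrier K" and u: "u \<in> U" and w: "w \<in> U"
      and eq: "a \<odot>\<^bsub>V\<^esub> v \<oplus>\<^bsub>V\<^esub> u = b \<odot>\<^bsub>V\<^esub> v \<oplus>\<^bsub>V\<^esub> w"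
    have c: "u \<in> carrier V" "w \<in> carrier V" using UD u w by auto
    \<comment> \<open>Closure of \<open>U\<close> under negation comes from scaling by -1.\<close>
    have "\<ominus>\<^bsub>V\<^esub> u = (\<ominus>\<^bsub>K\<^esub> \<one>\<^bsub>K\<^esub>) \<odot>\<^bsub>V\<^esub> u"
      using c by (simp add: smult_minus_1)
    then have mem: "w \<oplus>\<^bsub>V\<^esub> \<ominus>\<^bsub>V\<^esub> u \<in> U"
      using UD u w by auto
    have "(a \<ominus>\<^bsub>K\<^esub> b) \<odot>\<^bsub>V\<^esub> v = a \<odot>\<^bsub>V\<^esub> v \<oplus>\<^bsub>V\<^esub> \<ominus>\<^bsub>V\<^esub> (b \<odot>\<^bsub>V\<^esub> v)"
      using a b v by (simp add: a_minus_def smult_l_distr smult_l_minus)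
    also have "a \<odot>\<^bsub>V\<^esub> v = (b \<odot>\<^bsub>V\<^esub> v \<oplus>\<^bsub>V\<^esub> w) \<oplus>\<^bsub>V\<^esub> \<ominus>\<^bsub>V\<^esub> u"
      using eq a v c by (metis M.a_assoc M.r_neg M.r_zero M.a_inv_closed smult_closed)
    also have "\<dots> \<oplus>\<^bsub>V\<^esub> \<ominus>\<^bsub>V\<^esub> (b \<odot>\<^bsub>V\<^esub> v) = w \<oplus>\<^bsub>V\<^esub> \<ominus>\<^bsub>V\<^esub> u"
      using b v c by (simp add: M.a_ac M.r_neg M.r_neg1 M.r_neg2)
    finally have d: "(a \<ominus>\<^bsub>K\<^esub> b) \<odot>\<^bsub>V\<^esub> v = w \<oplus>\<^bsub>V\<^esub> \<ominus>\<^bsub>V\<^esub> u" .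
    have "a \<ominus>\<^bsub>K\<^esub> b = \<zero>\<^bsub>K\<^esub>"
    proof (rule ccontr)
      assume nz: "a \<ominus>\<^bsub>K\<^esub> b \<noteq> \<zero>\<^bsub>K\<^esub>"
      then have "v = (inv\<^bsub>K\<^esub> (a \<ominus>\<^bsub>K\<^esub> b)) \<odot>\<^bsub>V\<^esub> (w \<oplus>\<^bsub>V\<^esub> \<ominus>\<^bsub>V\<^esub> u)"
        using mult_inverse[OF _ v(1) d] a b by simp
      moreover have "inv\<^bsub>K\<^esub> (a \<ominus>\<^bsub>K\<^esub> b) \<in> carrier K"
        using nz a b field_Units by auto
      ultimately show False using UD(6) mem v(2) by metis
    qed
    then have ab: "a = b" using a b by simp
    moreover have "u = w" using eq ab b v c by simp
    ultimately show "a = b \<and> u = w" by simp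
  qed
  then show ?thesis
    by (simp add: adjoin_def card_image card_cartesian_product)
qed

lemma finite_superspaces [simp]: "finite (superspaces U m)"
proof (rule finite_subset)
  show "superspaces U m \<subseteq> Pow (carrier V)"
    using subspaceD(1) by (auto simp: superspaces_def)
qed (simp add: finite_vectors)

text \<open>A subspace that contains \<open>U\<close> and \<open>v\<close> contains their span, and
  the codimension drops by one. This is what matches the recursion of
  \<open>superspace_count\<close>.\<close>

lemma superspaces_adjoin:
  assumes U: "VectorSpace.subspace K U V" and v: "v \<in> carrier V" "v \<notin> U"
  shows "{W \<in> superspaces U (Suc m). v \<in> W} = superspaces (adjoin U v) m"
  using subset_adjoin[OF U v(1)] mem_adjoin[OF U v(1)]
  by (auto simp: superspaces_def card_adjoin[OF U v] dest: adjoin_subset)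

lemma superspaces_0 [simp]:
  assumes "VectorSpace.subspace K U V"
  shows "superspaces U 0 = {U}"
proof -
  have "W = U" if "W \<in> superspaces U 0" for W
    using that card_subset_eq[of W U] subspaceD(3)[of W] by (auto simp: superspaces_def)
  then show ?thesis
    using assms by (auto simp: superspaces_def)
qed

text \<open>Double counting of the pairs \<open>(v, W)\<close> with \<open>v\<close> in
  \<open>W - U\<close>: each \<open>W\<close> has \<open>(q ^ Suc m - 1) * card U\<close> such
  vectors, and each \<open>v\<close> outside \<open>U\<close> lies in the superspaces of
  \<open>adjoin U v\<close>, which the induction hypothesis counts.\<close>

lemma card_superspaces:
  assumes "VectorSpace.subspace K U V"
  shows "real (card (superspaces U m)) =
    superspace_count (card (carrier V)) (card (carrier K)) (card U) m"
  using assms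
proof (induction m arbitrary: U)
  case (0 U)
  then show ?case by simp
next
  case (Suc m U)
  note UD = subspaceD[OF Suc.prems]
  let ?q = "card (carrier K)" and ?S = "superspaces U (Suc m)" and ?Q = "card (carrier V)"
  have q: "?q \<ge> 2" by (rule card_scalars_ge_2)
  have "(\<Sum>W\<in>?S. card {v \<in> carrier V - U. v \<in> W}) =
        (\<Sum>v\<in>carrier V - U. card {W \<in> ?S. v \<in> W})"
    by (rule sum_multicount_gen) (auto simp: finite_vectors)
  moreover have "card {v \<in> carrier V - U. v \<in> W} = ?q ^ Suc m * card U - card U" if "W \<in> ?S" for W
  proof -
    have W: "VectorSpace.subspace K W V" "U \<subseteq> W" "card W = ?q ^ Suc m * card U"
      using that by (auto simp: superspaces_def)
    then have "{v \<in> carrier V - U. v \<in> W} = W - U" using subspaceD(1)[OF W(1)] by auto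
    then show ?thesis using W UD(3) by (simp add: card_Diff_subset)
  qed
  ultimately have "card ?S * (?q ^ Suc m * card U - card U) =
      (\<Sum>v\<in>carrier V - U. card {W \<in> ?S. v \<in> W})"
    by simp
  then have "real (card ?S * (?q ^ Suc m * card U - card U)) =
      (\<Sum>v\<in>carrier V - U. real (card {W \<in> ?S. v \<in> W}))"
    by (simp only: of_nat_sum)
  also have "\<dots> = (\<Sum>v\<in>carrier V - U. superspace_count ?Q ?q (?q * card U) m)"
    using Suc.prems
    by (intro sum.cong refl) (simp add: superspaces_adjoin Suc.IH subspace_adjoin card_adjoin)
  finally have "real (card ?S * (?q ^ Suc m * card U - card U)) =
      card (carrier V - U) * superspace_count ?Q ?q (?q * card U) m"
    by simp
  \<comment> \<open>These inequalities turn the truncated subtractions into real ones.\<close>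
  moreover have "card U \<le> ?q ^ Suc m * card U" using q by simp
  moreover have "card (carrier V - U) = ?Q - card U" "card U \<le> ?Q"
    using UD finite_vectors by (auto simp: card_Diff_subset card_mono)
  ultimately have "real (card ?S) * ((real ?q ^ Suc m - 1) * card U) =
      (real ?Q - card U) * superspace_count ?Q ?q (?q * card U) m"
    by (simp add: of_nat_diff algebra_simps)
  moreover have "real ?q ^ Suc m > 1" using q by (intro one_less_power) auto
  ultimately show ?case
    using UD(4) by (simp add: superspace_count_Suc field_simps)
qed

lemma card_line:
  assumes "v \<in> carrier V" "v \<noteq> \<zero>\<^bsub>V\<^esub>"
  shows "card (adjoin {\<zero>\<^bsub>V\<^esub>} v) = card (carrier K)"
  using card_adjoin[OF zero_subspace] assms by simp

section \<open>Random \<open>k\<close>-dimensional subspaces: probabilities of containing one or two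
  vectors\<close>

lemma card_superspaces_pos:
  assumes "card (carrier K) ^ k \<le> card (carrier V)"
  shows "card (superspaces {\<zero>\<^bsub>V\<^esub>} k) > 0"
proof -
  let ?q = "real (card (carrier K))"
  have q: "?q \<ge> 2" using card_scalars_ge_2 by simp
  have 1: "?q ^ i < ?q ^ k" if "i < k" for i
    using that q by (intro power_strict_increasing) auto
  have 2: "?q ^ k \<le> card (carrier V)"
    using assms by (metis of_nat_le_iff of_nat_power)
  have "0 < (card (carrier V) - ?q ^ i) / (?q ^ k - ?q ^ i)" if "i < k" for i
    using 1[OF that] 2 by (intro divide_pos_pos) linarith+
  then have "superspace_count (card (carrier V)) ?q 1 k > 0"
    unfolding superspace_count_def by (intro prod_pos) simp
  then show ?thesis
    using card_superspaces[OF zero_subspace, of k] by simp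
qed

text \<open>The probability is \<open>(q ^ k - 1) / (Q - 1)\<close>: the subspaces through
  \<open>v\<close> are the superspaces of its line, and one recursion step of
  \<open>superspace_count\<close> relates their number to the total.\<close>

lemma card_superspaces_containing:
  assumes v: "v \<in> carrier V" "v \<noteq> \<zero>\<^bsub>V\<^esub>" and "1 \<le> k"
  shows "real (card {W \<in> superspaces {\<zero>\<^bsub>V\<^esub>} k. v \<in> W}) * (real (card (carrier V)) - 1) =
    real (card (superspaces {\<zero>\<^bsub>V\<^esub>} k)) * (real (card (carrier K)) ^ k - 1)"
proof -
  obtain m where k: "k = Suc m" using \<open>1 \<le> k\<close> by (cases k) auto
  have "real (card (carrier K)) ^ k > 1"
    using card_scalars_ge_2 \<open>1 \<le> k\<close> by (intro one_less_power) auto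
  then show ?thesis
    using v zero_subspace unfolding k
    by (simp add: superspaces_adjoin card_superspaces subspace_adjoin card_line superspace_count_Suc)
qed

text \<open>Given that \<open>v\<close> lies in the subspace, \<open>w\<close> does so with
  probability \<open>(q ^ k - q) / (Q - q)\<close>. The recursion step now starts from the line
  through \<open>v\<close>, of size \<open>q\<close>.\<close>

lemma card_superspaces_containing2:
  assumes v: "v \<in> carrier V" "v \<noteq> \<zero>\<^bsub>V\<^esub>" and w: "w \<in> carrier V" "w \<notin> adjoin {\<zero>\<^bsub>V\<^esub>} v"
    and "1 \<le> k"
  shows "real (card {W \<in> superspaces {\<zero>\<^bsub>V\<^esub>} k. v \<in> W \<and> w \<in> W})
      * (real (card (carrier V)) - real (card (carrier K))) =
    real (card {W \<in> superspaces {\<zero>\<^bsub>V\<^esub>} k. v \<in> W})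
      * (real (card (carrier K)) ^ k - real (card (carrier K)))"
proof -
  obtain m where k: "k = Suc m" using \<open>1 \<le> k\<close> by (cases k) auto
  let ?L = "adjoin {\<zero>\<^bsub>V\<^esub>} v" and ?q = "real (card (carrier K))"
  have L: "VectorSpace.subspace K ?L V" by (rule subspace_adjoin[OF zero_subspace v(1)])
  have 1: "{W \<in> superspaces {\<zero>\<^bsub>V\<^esub>} k. v \<in> W} = superspaces ?L m"
    unfolding k using v by (simp add: superspaces_adjoin zero_subspace)
  then have 2: "{W \<in> superspaces {\<zero>\<^bsub>V\<^esub>} k. v \<in> W \<and> w \<in> W} = {W \<in> superspaces ?L m. w \<in> W}"
    by blast
  show ?thesis
  proof (cases m)
    \<comment> \<open>For \<open>k = 1\<close> the only subspace through \<open>v\<close> is its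
      line, which misses \<open>w\<close>, so both sides are 0.\<close>
    case 0
    have "{W \<in> superspaces ?L 0. w \<in> W} = {}"
      using w(2) L by auto
    then show ?thesis unfolding 2 by (simp add: k 0)
  next
    case (Suc l)
    have "?q ^ m > 1"
      using card_scalars_ge_2 Suc by (intro one_less_power) auto
    moreover have "?q > 0"
      using card_scalars_ge_2 by simp
    moreover have "?q ^ k - ?q = (?q ^ m - 1) * ?q"
      by (simp add: k algebra_simps)
    ultimately show ?thesis
      unfolding 2 1 Suc using w v L
      by (simp add: superspaces_adjoin card_superspaces subspace_adjoin card_line card_adjoin
          superspace_count_Suc)
  qed
qed

text \<open>Negative correlation: containing \<open>v\<close> does not make containing
  \<open>w\<close> more likely, because \<open>(q ^ k - q) / (Q - q)\<close> is at most
  \<open>(q ^ k - 1) / (Q - 1)\<close> when \<open>q ^ k\<close> is at most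
  \<open>Q\<close>.\<close>

lemma card_superspaces_containing2_le:
  assumes v: "v \<in> carrier V" "v \<noteq> \<zero>\<^bsub>V\<^esub>" and w: "w \<in> carrier V" "w \<notin> adjoin {\<zero>\<^bsub>V\<^esub>} v"
    and k: "1 \<le> k" "card (carrier K) ^ k \<le> card (carrier V)"
  shows "real (card {W \<in> superspaces {\<zero>\<^bsub>V\<^esub>} k. v \<in> W \<and> w \<in> W})
      \<le> (real (card {W \<in> superspaces {\<zero>\<^bsub>V\<^esub>} k. v \<in> W}))\<^sup>2 / card (superspaces {\<zero>\<^bsub>V\<^esub>} k)"
proof -
  define q Q where "q = real (card (carrier K))" and "Q = real (card (carrier V))"
  define G N1 N2 where "G = real (card (superspaces {\<zero>\<^bsub>V\<^esub>} k))"
    and "N1 = real (card {W \<in> superspaces {\<zero>\<^bsub>V\<^esub>} k. v \<in> W})"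
    and "N2 = real (card {W \<in> superspaces {\<zero>\<^bsub>V\<^esub>} k. v \<in> W \<and> w \<in> W})"
  have "adjoin {\<zero>\<^bsub>V\<^esub>} v \<subset> carrier V"
    using w subspaceD(1)[OF subspace_adjoin[OF zero_subspace v(1)]] by blast
  from psubset_card_mono[OF finite_vectors this] have "q < Q"
    by (simp add: q_def Q_def card_line[OF v])
  have "q \<ge> 2" using card_scalars_ge_2 by (simp add: q_def)
  have "q ^ k \<le> Q"
    unfolding q_def Q_def using k(2) by (metis of_nat_le_iff of_nat_power)
  have "q ^ k \<ge> q ^ 1" using k(1) \<open>q \<ge> 2\<close> by (intro power_increasing) auto
  have 1: "N1 = G * (q ^ k - 1) / (Q - 1)"
    using card_superspaces_containing[OF v k(1)] \<open>q < Q\<close> \<open>q \<ge> 2\<close>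
    by (simp add: G_def N1_def q_def Q_def field_simps)
  have 2: "N2 = N1 * (q ^ k - q) / (Q - q)"
    using card_superspaces_containing2[OF v w k(1)] \<open>q < Q\<close>
    by (simp add: N2_def N1_def q_def Q_def field_simps)
  \<comment> \<open>This product is the difference of the two sides after
    cross-multiplication.\<close>
  have "0 \<le> (q - 1) * (Q - q ^ k)" using \<open>q \<ge> 2\<close> \<open>q ^ k \<le> Q\<close> by simp
  then have "(q ^ k - q) * (Q - 1) \<le> (q ^ k - 1) * (Q - q)"
    by (simp add: algebra_simps)
  then have "(q ^ k - q) / (Q - q) \<le> (q ^ k - 1) / (Q - 1)"
    using \<open>q < Q\<close> \<open>q \<ge> 2\<close> by (simp add: divide_simps)
  then have "N1 * ((q ^ k - q) / (Q - q)) \<le> N1 * ((q ^ k - 1) / (Q - 1))"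
    by (intro mult_left_mono) (auto simp: N1_def)
  then have "N2 \<le> N1 * ((q ^ k - 1) / (Q - 1))"
    by (simp add: 2)
  also have "\<dots> = N1\<^sup>2 / G"
    using 1 card_superspaces_pos[OF k(2)] by (simp add: G_def power2_eq_square)
  finally show ?thesis by (simp add: G_def N1_def N2_def)
qed

text \<open>Chebyshev's inequality for the number of vectors of \<open>B\<close> in a uniformly random
  \<open>k\<close>-dimensional subspace. Containing one vector and containing another, non-proportional one are
  negatively correlated events, so only proportional pairs contribute to the variance.\<close>
lemma card_superspaces_avoiding_le:
  assumes B: "B \<subseteq> carrier V - {\<zero>\<^bsub>V\<^esub>}"
    and k: "1 \<le> k" "card (carrier K) ^ k \<le> card (carrier V)"
  shows "real (card {W \<in> superspaces {\<zero>\<^bsub>V\<^esub>} k. W \<inter> B = {}})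
      * (real (card B) * (real (card (carrier K)) ^ k - 1))
    \<le> real (card (superspaces {\<zero>\<^bsub>V\<^esub>} k))
      * ((real (card (carrier K)) - 1) * (real (card (carrier V)) - 1))"
proof (cases "B = {}")
  case True
  have "1 \<le> card (carrier K)" "1 \<le> card (carrier V)"
    using card_scalars_ge_2 k(2) by (auto intro: order_trans[OF _ k(2)])
  then show ?thesis using True by simp
next
  case False
  define q Q where "q = real (card (carrier K))" and "Q = real (card (carrier V))"
  define S where "S = superspaces {\<zero>\<^bsub>V\<^esub>} k"
  \<comment> \<open>For uniform \<open>W\<close> in \<open>S\<close>, \<open>p\<close> is the
    probability of containing a fixed nonzero vector, \<open>X\<close> counts the vectors of
    \<open>B\<close> in \<open>W\<close>, and \<open>\<mu>\<close> is the mean of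
    \<open>X\<close>.\<close>
  define G b p where "G = real (card S)" and "b = real (card B)" and "p = (q ^ k - 1) / (Q - 1)"
  define X where "X W = (\<Sum>v\<in>B. of_bool (v \<in> W) :: real)" for W
  define \<mu> where "\<mu> = b * p"
  have fB: "finite B" using B finite_vectors finite_subset by blast
  have fS: "finite S" by (simp add: S_def)
  have "b > 0" using False fB by (simp add: b_def card_gt_0_iff)
  have "q \<ge> 2" using card_scalars_ge_2 by (simp add: q_def)
  have "q ^ k \<le> Q"
    unfolding q_def Q_def using k(2) by (metis of_nat_le_iff of_nat_power)
  have "q ^ k \<ge> q ^ 1" using k(1) \<open>q \<ge> 2\<close> by (intro power_increasing) auto
  have "p > 0" using \<open>q \<ge> 2\<close> \<open>q ^ k \<ge> q ^ 1\<close> \<open>q ^ k \<le> Q\<close> by (simp add: p_def)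
  have "G > 0" using card_superspaces_pos[OF k(2)] by (simp add: G_def S_def)
  have N1: "(\<Sum>W\<in>S. of_bool (v \<in> W)) = G * p" if "v \<in> B" for v
  proof -
    have "(\<Sum>W\<in>S. of_bool (v \<in> W)) = real (card {W \<in> S. v \<in> W})"
      using fS by (simp add: Int_def)
    also have "\<dots> = G * p"
      using card_superspaces_containing[of v k] that B k(1) \<open>q ^ k \<ge> q ^ 1\<close> \<open>q \<ge> 2\<close> \<open>q ^ k \<le> Q\<close>
      by (auto simp: S_def G_def p_def q_def Q_def field_simps)
    finally show ?thesis .
  qed
  \<comment> \<open>Off the line of \<open>v\<close> negative correlation gives
    \<open>p\<^sup>2\<close>; on that line the joint probability is bounded by
    \<open>p\<close>.\<close>
  have N2: "(\<Sum>W\<in>S. of_bool (v \<in> W) * of_bool (w \<in> W)) \<le>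
      G * p\<^sup>2 + of_bool (w \<in> adjoin {\<zero>\<^bsub>V\<^esub>} v) * (G * p)"
    if v: "v \<in> B" and w: "w \<in> B" for v w
  proof (cases "w \<in> adjoin {\<zero>\<^bsub>V\<^esub>} v")
    case True
    have "(\<Sum>W\<in>S. of_bool (v \<in> W) * of_bool (w \<in> W)) \<le> (\<Sum>W\<in>S. of_bool (v \<in> W) :: real)"
      by (intro sum_mono) auto
    then show ?thesis using N1[OF v] True \<open>G > 0\<close> by (simp add: add_increasing)
  next
    case False
    have "(\<Sum>W\<in>S. of_bool (v \<in> W) * of_bool (w \<in> W)) = real (card {W \<in> S. v \<in> W \<and> w \<in> W})"
      using fS by (simp add: Int_def flip: of_bool_conj)
    also have "\<dots> \<le> (real (card {W \<in> S. v \<in> W}))\<^sup>2 / G"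
      unfolding S_def G_def using v w B False k by (intro card_superspaces_containing2_le) auto
    also have "real (card {W \<in> S. v \<in> W}) = (\<Sum>W\<in>S. of_bool (v \<in> W))"
      using fS by (simp add: Int_def)
    finally show ?thesis
      using N1[OF v] False \<open>G > 0\<close> by (simp add: power2_eq_square mult_ac)
  qed
  \<comment> \<open>A line has \<open>q - 1\<close> nonzero vectors, so each \<open>v\<close> has at
    most that many proportional partners in \<open>B\<close>.\<close>
  have line: "(\<Sum>w\<in>B. of_bool (w \<in> adjoin {\<zero>\<^bsub>V\<^esub>} v)) \<le> q - 1" if v: "v \<in> B" for v
  proof -
    let ?L = "adjoin {\<zero>\<^bsub>V\<^esub>} v"
    have v': "v \<in> carrier V" "v \<noteq> \<zero>\<^bsub>V\<^esub>" using v B by auto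
    note L = subspaceD[OF subspace_adjoin[OF zero_subspace v'(1)]]
    have "(\<Sum>w\<in>B. of_bool (w \<in> ?L)) = real (card (B \<inter> ?L))"
      using fB by (simp add: Int_def)
    also have "\<dots> \<le> real (card (?L - {\<zero>\<^bsub>V\<^esub>}))"
      using L(3) B by (intro of_nat_mono card_mono) auto
    also have "\<dots> = q - 1"
      using L(2,3) card_line[OF v'] card_scalars_ge_2 by (simp add: q_def of_nat_diff)
    finally show ?thesis .
  qed
  have EX: "(\<Sum>W\<in>S. X W) = G * \<mu>"
  proof -
    have "(\<Sum>W\<in>S. X W) = (\<Sum>v\<in>B. \<Sum>W\<in>S. of_bool (v \<in> W))"
      unfolding X_def by (rule sum.swap)
    also have "\<dots> = (\<Sum>v\<in>B. G * p)" by (intro sum.cong refl N1)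
    finally show ?thesis by (simp add: b_def \<mu>_def)
  qed
  have "(\<Sum>W\<in>S. (X W)\<^sup>2) = (\<Sum>v\<in>B. \<Sum>w\<in>B. \<Sum>W\<in>S. of_bool (v \<in> W) * of_bool (w \<in> W))"
    unfolding X_def power2_eq_square sum_product
    by (subst sum.swap, rule sum.cong[OF refl], rule sum.swap)
  also have "\<dots> \<le> (\<Sum>v\<in>B. \<Sum>w\<in>B. G * p\<^sup>2 + of_bool (w \<in> adjoin {\<zero>\<^bsub>V\<^esub>} v) * (G * p))"
    by (intro sum_mono N2)
  also have "\<dots> = (\<Sum>v\<in>B. b * (G * p\<^sup>2) + (\<Sum>w\<in>B. of_bool (w \<in> adjoin {\<zero>\<^bsub>V\<^esub>} v)) * (G * p))"
    by (simp only: sum.distrib sum_distrib_right) (simp add: b_def)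
  also have "\<dots> \<le> (\<Sum>v\<in>B. b * (G * p\<^sup>2) + (q - 1) * (G * p))"
    using \<open>G > 0\<close> \<open>p > 0\<close> by (intro sum_mono add_left_mono mult_right_mono line) auto
  also have "\<dots> = G * \<mu>\<^sup>2 + (q - 1) * G * \<mu>"
    by (simp add: b_def \<mu>_def power2_eq_square algebra_simps)
  finally have EX2: "(\<Sum>W\<in>S. (X W)\<^sup>2) \<le> G * \<mu>\<^sup>2 + (q - 1) * G * \<mu>" .
  \<comment> \<open>A subspace that avoids \<open>B\<close> has \<open>X W = 0\<close>, so it
    contributes exactly \<open>\<mu>\<^sup>2\<close> to the sum of squared deviations.\<close>
  have "real (card {W \<in> S. W \<inter> B = {}}) * \<mu>\<^sup>2 = (\<Sum>W\<in>{W \<in> S. W \<inter> B = {}}. (X W - \<mu>)\<^sup>2)"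
  proof -
    have "X W = 0" if "W \<inter> B = {}" for W
      unfolding X_def using that by (intro sum.neutral) auto
    then show ?thesis by simp
  qed
  also have "\<dots> \<le> (\<Sum>W\<in>S. (X W - \<mu>)\<^sup>2)"
    using fS by (intro sum_mono2) auto
  also have "\<dots> = (\<Sum>W\<in>S. (X W)\<^sup>2) - 2 * \<mu> * (\<Sum>W\<in>S. X W) + G * \<mu>\<^sup>2"
    by (simp add: power2_diff sum.distrib sum_subtractf sum_distrib_left sum_distrib_right
        G_def algebra_simps)
  also have "\<dots> \<le> (q - 1) * G * \<mu>"
    using EX2 EX by (simp add: power2_eq_square algebra_simps)
  finally have "real (card {W \<in> S. W \<inter> B = {}}) * \<mu> * \<mu> \<le> ((q - 1) * G) * \<mu>"
    by (simp add: power2_eq_square mult.assoc)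
  moreover have "\<mu> > 0" using \<open>b > 0\<close> \<open>p > 0\<close> by (simp add: \<mu>_def)
  ultimately have "real (card {W \<in> S. W \<inter> B = {}}) * \<mu> \<le> (q - 1) * G"
    by (rule mult_right_le_imp_le)
  then have "real (card {W \<in> S. W \<inter> B = {}}) * (b * (q ^ k - 1)) \<le> G * ((q - 1) * (Q - 1))"
    using \<open>q ^ k \<ge> q ^ 1\<close> \<open>q ^ k \<le> Q\<close> \<open>q \<ge> 2\<close> by (simp add: \<mu>_def p_def field_simps)
  then show ?thesis by (simp add: S_def G_def b_def q_def Q_def)
qed

text \<open>Union bound over the lines contained in \<open>B\<close>.\<close>
lemma card_superspaces_meeting_le:
  assumes B: "B \<subseteq> carrier V - {\<zero>\<^bsub>V\<^esub>}"
    and scale: "\<And>a v. a \<in> carrier K \<Longrightarrow> a \<noteq> \<zero>\<^bsub>K\<^esub> \<Longrightarrow> v \<in> B \<Longrightarrow> a \<odot>\<^bsub>V\<^esub> v \<in> B"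
    and k: "1 \<le> k"
  shows "real (card {W \<in> superspaces {\<zero>\<^bsub>V\<^esub>} k. W \<inter> B \<noteq> {}})
      * ((real (card (carrier K)) - 1) * (real (card (carrier V)) - 1))
    \<le> real (card (superspaces {\<zero>\<^bsub>V\<^esub>} k))
      * (real (card B) * (real (card (carrier K)) ^ k - 1))"
proof -
  let ?q = "real (card (carrier K))" and ?Q = "real (card (carrier V))"
  let ?S = "superspaces {\<zero>\<^bsub>V\<^esub>} k"
  have fB: "finite B" using B finite_vectors finite_subset by blast
  have "card {\<zero>\<^bsub>V\<^esub>} \<le> card (carrier V)"
    by (intro card_mono finite_vectors) auto
  then have Q1: "?Q \<ge> 1" by simp
  \<comment> \<open>As \<open>B\<close> is closed under nonzero scalars, a subspace meeting
    \<open>B\<close> contains all \<open>q - 1\<close> nonzero vectors of some line inside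
    \<open>B\<close>.\<close>
  have "?q - 1 \<le> real (card {v \<in> B. v \<in> W})" if W: "W \<in> ?S" "W \<inter> B \<noteq> {}" for W
  proof -
    obtain v where v: "v \<in> W" "v \<in> B" using W by auto
    then have v': "v \<in> carrier V" "v \<noteq> \<zero>\<^bsub>V\<^esub>" using B by auto
    let ?L = "adjoin {\<zero>\<^bsub>V\<^esub>} v"
    note L = subspaceD[OF subspace_adjoin[OF zero_subspace v'(1)]]
    have W': "VectorSpace.subspace K W V" "\<zero>\<^bsub>V\<^esub> \<in> W" using W by (auto simp: superspaces_def)
    have "?L - {\<zero>\<^bsub>V\<^esub>} \<subseteq> {v \<in> B. v \<in> W}"
    proof
      fix x assume x: "x \<in> ?L - {\<zero>\<^bsub>V\<^esub>}"
      then obtain a where "a \<in> carrier K" "x = a \<odot>\<^bsub>V\<^esub> v"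
        using v' by (auto simp: adjoin_def)
      moreover from this have "a \<noteq> \<zero>\<^bsub>K\<^esub>" using x v' by auto
      ultimately show "x \<in> {v \<in> B. v \<in> W}"
        using scale v subspaceD(6)[OF W'(1)] by auto
    qed
    then have "card (?L - {\<zero>\<^bsub>V\<^esub>}) \<le> card {v \<in> B. v \<in> W}"
      using fB by (intro card_mono) auto
    then show ?thesis
      using L(2,3) card_line[OF v'] card_scalars_ge_2 by simp
  qed
  then have "real (card {W \<in> ?S. W \<inter> B \<noteq> {}}) * (?q - 1) \<le>
      (\<Sum>W\<in>{W \<in> ?S. W \<inter> B \<noteq> {}}. real (card {v \<in> B. v \<in> W}))"
    using sum_bounded_below[of "{W \<in> ?S. W \<inter> B \<noteq> {}}" "?q - 1" "\<lambda>W. real (card {v \<in> B. v \<in> W})"]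
    by simp
  also have "\<dots> \<le> (\<Sum>W\<in>?S. real (card {v \<in> B. v \<in> W}))"
    by (intro sum_mono2) auto
  \<comment> \<open>The incidences between \<open>B\<close> and the subspaces are now counted by
    vectors, so that the containment probability applies to each summand.\<close>
  also have "\<dots> = (\<Sum>v\<in>B. real (card {W \<in> ?S. v \<in> W}))"
    unfolding of_nat_sum[symmetric]
    by (rule arg_cong[of _ _ real], rule sum_multicount_gen) (auto simp: fB)
  finally have "real (card {W \<in> ?S. W \<inter> B \<noteq> {}}) * (?q - 1) * (?Q - 1) \<le>
      (\<Sum>v\<in>B. real (card {W \<in> ?S. v \<in> W})) * (?Q - 1)"
    using Q1 by (intro mult_right_mono) auto
  also have "\<dots> = (\<Sum>v\<in>B. real (card ?S) * (?q ^ k - 1))"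
    unfolding sum_distrib_right using B k
    by (intro sum.cong refl card_superspaces_containing) auto
  finally show ?thesis by (simp add: mult_ac)
qed

end

section \<open>Rank over a finite field\<close>

lemma (in cring) func_space_finsum_apply:
  assumes "finite A" "f \<in> A \<rightarrow> carrier (func_space S)" "i \<in> S"
  shows "(\<Oplus>\<^bsub>func_space S\<^esub>x\<in>A. f x) i = (\<Oplus>x\<in>A. f x i)"
proof -
  interpret M: Module.module R "func_space S" by (rule func_space_is_module)
  show ?thesis
    using assms
  proof (induction A rule: finite_induct)
    case empty
    then show ?case
      using M.M.finsum_empty[of f] by (simp add: func_space_def)
  next
    case (insert x A)
    moreover have "(\<lambda>y. f y i) \<in> A \<rightarrow> carrier R" "f x i \<in> carrier R"
      using insert.prems by (auto simp: func_space_def)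
    moreover have "(f x \<oplus>\<^bsub>func_space S\<^esub> g) i = f x i \<oplus> g i" for g
      using insert.prems by (simp add: func_space_def)
    ultimately show ?case by (simp add: M.M.finsum_insert Pi_iff)
  qed
qed

lemma (in Module.module) submodule_finsum_closed:
  assumes N: "LinearCombinations.submodule R N M" and "finite A" "f \<in> A \<rightarrow> N"
  shows "(\<Oplus>\<^bsub>M\<^esub>x\<in>A. f x) \<in> N"
  using assms(2,3)
proof (induction A rule: finite_induct)
  case empty
  then show ?case using N by (simp add: M.finsum_empty LinearCombinations.submodule.zero_closed)
next
  case (insert x A)
  have "f \<in> insert x A \<rightarrow> carrier M"
    using insert.prems LinearCombinations.submodule.subset[OF N] by auto
  then show ?case
    using insert LinearCombinations.submodule.m_closed[OF N] by (simp add: M.finsum_insert Pi_iff)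
qed

locale finite_field = field R for R :: "'a ring" (structure) +
  assumes finite_carrier: "finite (carrier R)"

text \<open>A minimal spanning set of columns is a basis of the column space. \<open>S\<close>
  indexes such a basis, and \<open>c (s, j)\<close> is the coefficient of column \<open>s\<close> in
  column \<open>j\<close>.\<close>

lemma (in finite_field) matrix_rank_witness:
  assumes A: "A \<in> carrier (matrix_space R n)"
  obtains S c where "S \<subseteq> {..<n}" "card S = matrix_rank R n A" "c \<in> S \<times> {..<n} \<rightarrow> carrier R"
    "\<forall>i<n. \<forall>j<n. A (i, j) = (\<Oplus>s\<in>S. c (s, j) \<otimes> A (i, s))"
proof -
  let ?V = "column_space R n" and ?T = "column n A ` {..<n}"
  interpret V: vectorspace R ?V
    by (intro vectorspace.intro func_space_is_module) unfold_locales
  have A': "A (i, j) \<in> carrier R" if "i < n" "j < n" for i j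
    using A that by (auto simp: func_space_def)
  then have T: "?T \<subseteq> carrier ?V" "finite ?T"
    by (auto simp: func_space_def column_def split: if_splits)
  let ?W = "?V\<lparr>carrier := V.span ?T\<rparr>"
  have sub: "LinearCombinations.submodule R (V.span ?T) ?V"
    using T(1) by (rule V.span_is_submodule)
  interpret W: vectorspace R ?W
    using V.span_is_subspace[OF T(1)] by (rule V.subspace_is_vs)
  have TW: "?T \<subseteq> V.span ?T" using T(1) by (rule V.in_own_span)
  have "?T \<subseteq> carrier ?W \<and> W.gen_set ?T"
    using TW V.span_li_not_depend(1)[OF TW sub] by simp
  then obtain \<beta> where \<beta>: "\<beta> \<subseteq> ?T" "minimal \<beta> (\<lambda>S. S \<subseteq> carrier ?W \<and> W.gen_set S)"
    using minimal_exists[OF T(2), of "\<lambda>S. S \<subseteq> carrier ?W \<and> W.gen_set S"] by blast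
  have fin: "finite \<beta>" using \<beta>(1) T(2) finite_subset by blast
  have basis: "W.basis \<beta>" using \<beta>(2) by (rule W.min_gen_is_basis)
  have rank: "card \<beta> = matrix_rank R n A"
    using W.dim_basis[OF fin basis] by (simp add: matrix_rank_def)
  have span: "V.span ?T = V.span \<beta>"
    using V.span_li_not_depend(1)[OF order_trans[OF \<beta>(1) TW] sub] basis by (simp add: W.basis_def)
  \<comment> \<open>Different indices may carry equal columns; one index per basis vector is chosen
    so that \<open>S\<close> has the size of the basis.\<close>
  obtain S where S: "S \<subseteq> {..<n}" "inj_on (column n A) S" "\<beta> = column n A ` S"
    using \<beta>(1) subset_image_inj by metis
  have "\<exists>a. a \<in> \<beta> \<rightarrow> carrier R \<and> V.lincomb a \<beta> = column n A j" if "j < n" for j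
  proof (rule V.finite_in_span[OF fin])
    show "\<beta> \<subseteq> carrier ?V" using \<beta>(1) T(1) by blast
    show "column n A j \<in> V.span \<beta>" using that TW span by auto
  qed
  then obtain a where a: "a j \<in> \<beta> \<rightarrow> carrier R" "V.lincomb (a j) \<beta> = column n A j" if "j < n" for j
    by metis
  show thesis
  proof
    show "S \<subseteq> {..<n}" by fact
    show "card S = matrix_rank R n A"
      using rank S(2,3) by (simp add: card_image)
    show "(\<lambda>(s, j). a j (column n A s)) \<in> S \<times> {..<n} \<rightarrow> carrier R"
      using a(1) S(3) by auto
    show "\<forall>i<n. \<forall>j<n. A (i, j) = (\<Oplus>s\<in>S. (case (s, j) of (s, j) \<Rightarrow> a j (column n A s)) \<otimes> A (i, s))"
    proof (intro allI impI)
      fix i j assume i: "i < n" and j: "j < n"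
      have "A (i, j) = V.lincomb (a j) \<beta> i"
        using a(2)[OF j] i by (simp add: column_def)
      also have "\<dots> = (\<Oplus>v\<in>\<beta>. (a j v \<odot>\<^bsub>?V\<^esub> v) i)"
        unfolding V.lincomb_def
      proof (rule func_space_finsum_apply[OF fin])
        show "(\<lambda>v. a j v \<odot>\<^bsub>?V\<^esub> v) \<in> \<beta> \<rightarrow> carrier ?V"
          using a(1)[OF j] \<beta>(1) T(1) by (intro Pi_I V.smult_closed) auto
      qed (use i in auto)
      also have "\<dots> = (\<Oplus>s\<in>S. (a j (column n A s) \<odot>\<^bsub>?V\<^esub> column n A s) i)"
        unfolding S(3)
      proof (rule finsum_reindex[OF _ S(2)])
        show "(\<lambda>v. (a j v \<odot>\<^bsub>?V\<^esub> v) i) \<in> column n A ` S \<rightarrow> carrier R"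
        proof
          fix v assume v: "v \<in> column n A ` S"
          then have "a j v \<in> carrier R" "v i \<in> carrier R"
            using a(1)[OF j] S(1,3) A' i by (auto simp: column_def)
          then show "(a j v \<odot>\<^bsub>?V\<^esub> v) i \<in> carrier R"
            using i by (simp add: func_space_def)
        qed
      qed
      also have "\<dots> = (\<Oplus>s\<in>S. (case (s, j) of (s, j) \<Rightarrow> a j (column n A s)) \<otimes> A (i, s))"
      proof (rule finsum_cong')
        show "(\<lambda>s. (case (s, j) of (s, j) \<Rightarrow> a j (column n A s)) \<otimes> A (i, s)) \<in> S \<rightarrow> carrier R"
          using a(1)[OF j] S(1,3) A' i by (auto intro!: m_closed)
      qed (use i in \<open>auto simp: func_space_def column_def\<close>)
      finally show "A (i, j) = (\<Oplus>s\<in>S. (case (s, j) of (s, j) \<Rightarrow> a j (column n A s)) \<otimes> A (i, s))" .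
    qed
  qed
qed

text \<open>A factorisation through \<open>I\<close> places all columns in the span of
  \<open>card I\<close> vectors, and a linearly independent set in that span has at most
  \<open>card I\<close> elements.\<close>

lemma (in finite_field) matrix_rank_le:
  assumes A: "A \<in> carrier (matrix_space R n)"
    and fin: "finite I" and c: "c \<in> I \<times> {..<n} \<rightarrow> carrier R" and l: "l \<in> {..<n} \<times> I \<rightarrow> carrier R"
    and eq: "\<And>i j. i < n \<Longrightarrow> j < n \<Longrightarrow> A (i, j) = (\<Oplus>t\<in>I. c (t, j) \<otimes> l (i, t))"
  shows "matrix_rank R n A \<le> card I"
proof -
  let ?V = "column_space R n" and ?T = "column n A ` {..<n}"
  define v where "v t = (\<lambda>i\<in>{..<n}. l (i, t))" for t
  interpret V: vectorspace R ?V
    by (intro vectorspace.intro func_space_is_module) unfold_locales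
  have v: "v \<in> I \<rightarrow> carrier ?V"
    using l by (auto simp: func_space_def v_def split: if_splits)
  have A': "A (i, j) \<in> carrier R" if "i < n" "j < n" for i j
    using A that by (auto simp: func_space_def)
  then have T: "?T \<subseteq> carrier ?V" "finite ?T"
    by (auto simp: func_space_def column_def split: if_splits)
  let ?U = "?V\<lparr>carrier := V.span (v ` I)\<rparr>"
  let ?W = "?V\<lparr>carrier := V.span ?T\<rparr>"
  have vI: "v ` I \<subseteq> carrier ?V" using v by auto
  have subU: "LinearCombinations.submodule R (V.span (v ` I)) ?V"
    using vI by (rule V.span_is_submodule)
  have subW: "LinearCombinations.submodule R (V.span ?T) ?V"
    using T(1) by (rule V.span_is_submodule)
  interpret U: vectorspace R ?U
    using V.span_is_subspace[OF vI] by (rule V.subspace_is_vs)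
  interpret W: vectorspace R ?W
    using V.span_is_subspace[OF T(1)] by (rule V.subspace_is_vs)
  have mem: "column n A j \<in> V.span (v ` I)" if j: "j < n" for j
  proof -
    have cv: "(\<lambda>t. c (t, j) \<odot>\<^bsub>?V\<^esub> v t) \<in> I \<rightarrow> carrier ?V"
      using c v j by (intro Pi_I V.smult_closed) auto
    have "column n A j = (\<Oplus>\<^bsub>?V\<^esub>t\<in>I. c (t, j) \<odot>\<^bsub>?V\<^esub> v t)"
    proof (rule extensionalityI[of _ "{..<n}"])
      show "column n A j \<in> extensional {..<n}" by (simp add: column_def)
      have "(\<Oplus>\<^bsub>?V\<^esub>t\<in>I. c (t, j) \<odot>\<^bsub>?V\<^esub> v t) \<in> carrier ?V"
        using cv by (rule V.M.finsum_closed)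
      then show "(\<Oplus>\<^bsub>?V\<^esub>t\<in>I. c (t, j) \<odot>\<^bsub>?V\<^esub> v t) \<in> extensional {..<n}"
        by (auto simp: func_space_def PiE_def)
      fix i assume i: "i \<in> {..<n}"
      then have "(\<Oplus>\<^bsub>?V\<^esub>t\<in>I. c (t, j) \<odot>\<^bsub>?V\<^esub> v t) i = (\<Oplus>t\<in>I. (c (t, j) \<odot>\<^bsub>?V\<^esub> v t) i)"
        by (intro func_space_finsum_apply fin cv)
      also have "\<dots> = (\<Oplus>t\<in>I. c (t, j) \<otimes> l (i, t))"
        using i j c l by (intro finsum_cong') (auto simp: func_space_def v_def)
      finally show "column n A j i = (\<Oplus>\<^bsub>?V\<^esub>t\<in>I. c (t, j) \<odot>\<^bsub>?V\<^esub> v t) i"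
        using eq i j by (simp add: column_def)
    qed
    also have "\<dots> \<in> V.span (v ` I)"
    proof (rule V.submodule_finsum_closed[OF subU fin], rule Pi_I)
      fix t assume "t \<in> I"
      then show "c (t, j) \<odot>\<^bsub>?V\<^esub> v t \<in> V.span (v ` I)"
        using c j V.in_own_span[OF vI] by (intro LinearCombinations.submodule.smult_closed[OF subU]) auto
    qed
    finally show ?thesis .
  qed
  have "W.fin_dim"
    unfolding W.fin_dim_def
    using T(2) V.in_own_span[OF T(1)] V.span_li_not_depend(1)[OF V.in_own_span[OF T(1)] subW]
    by (intro exI[of _ ?T]) simp
  then obtain \<beta> where \<beta>: "finite \<beta>" "W.basis \<beta>"
    using W.finite_basis_exists by blast
  have \<beta>W: "\<beta> \<subseteq> V.span ?T" using \<beta>(2) by (simp add: W.basis_def)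
  have "V.span ?T \<subseteq> V.span (v ` I)"
    using mem by (intro V.span_is_subset subU) auto
  then have \<beta>U: "\<beta> \<subseteq> V.span (v ` I)" using \<beta>W by blast
  have "V.lin_indpt \<beta>"
    using \<beta>(2) V.span_li_not_depend(2)[OF \<beta>W subW] by (simp add: W.basis_def)
  then have "card \<beta> \<le> card (v ` I)"
    using V.span_li_not_depend(2)[OF \<beta>U subU] V.in_own_span[OF vI] \<beta>(1) fin \<beta>U
      V.span_li_not_depend(1)[OF V.in_own_span[OF vI] subU]
    by (intro U.li_smaller_than_gen) auto
  also have "\<dots> \<le> card I" using fin by (rule card_image_le)
  finally show ?thesis
    using W.dim_basis[OF \<beta>] by (simp add: matrix_rank_def)
qed

section \<open>Counting symmetric matrices of low rank\<close>

text \<open>Positions in the upper triangle that determine the rows and columns of a symmetric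
  matrix with index in \<open>S\<close>. All of \<open>{..<n}\<close> gives coordinates of the whole
  space; \<open>{..<d - 1}\<close> gives the exponent in the count of low-rank matrices.\<close>

definition upper_pairs :: "nat \<Rightarrow> nat set \<Rightarrow> (nat \<times> nat) set" where
  "upper_pairs n S = {(i, j). i \<le> j \<and> j < n \<and> (i \<in> S \<or> j \<in> S)}"

lemma upper_pairs_subset: "upper_pairs n S \<subseteq> {..<n} \<times> {..<n}"
  by (auto simp: upper_pairs_def)

lemma finite_upper_pairs [simp]: "finite (upper_pairs n S)"
  using upper_pairs_subset by (rule finite_subset) simp

lemma card_ordered_pairs:
  fixes S :: "nat set"
  assumes "finite S"
  shows "2 * card {(i, j). i \<in> S \<and> j \<in> S \<and> i \<le> j} = card S * (card S + 1)"
  using assms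
proof (induction S rule: finite_linorder_max_induct)
  case empty
  then show ?case by simp
next
  case (insert b S)
  let ?P = "\<lambda>S. {(i, j). i \<in> S \<and> j \<in> S \<and> (i::nat) \<le> j}"
  have "b \<notin> S" using insert.hyps(2) by auto
  have "?P (insert b S) = ?P S \<union> insert b S \<times> {b}"
    using insert.hyps(2) by (fastforce dest: leD)
  moreover have "finite (?P S)"
    by (rule finite_subset[of _ "S \<times> S"]) (use insert.hyps(1) in auto)
  moreover have "?P S \<inter> insert b S \<times> {b} = {}"
    using \<open>b \<notin> S\<close> by auto
  ultimately have "card (?P (insert b S)) = card (?P S) + Suc (card S)"
    using insert.hyps(1) \<open>b \<notin> S\<close> by (simp add: card_Un_disjoint card_cartesian_product)
  then show ?case
    using insert.IH insert.hyps(1) \<open>b \<notin> S\<close> by simp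
qed

text \<open>The remaining pairs of the triangle are the ordered pairs in the complement of
  \<open>S\<close>, so only \<open>card S\<close> matters. Doubling avoids halving triangular
  numbers.\<close>

lemma card_upper_pairs:
  assumes S: "S \<subseteq> {..<n}"
  shows "2 * card (upper_pairs n S) + (n - card S) * (n - card S + 1) = n * (n + 1)"
proof -
  let ?P = "\<lambda>S. {(i, j). i \<in> S \<and> j \<in> S \<and> (i::nat) \<le> j}"
  have "?P {..<n} = upper_pairs n S \<union> ?P ({..<n} - S)"
    by (auto simp: upper_pairs_def)
  moreover have "upper_pairs n S \<inter> ?P ({..<n} - S) = {}"
    by (auto simp: upper_pairs_def)
  moreover have "finite (?P ({..<n} - S))"
    by (rule finite_subset[of _ "{..<n} \<times> {..<n}"]) auto
  ultimately have "card (?P {..<n}) = card (upper_pairs n S) + card (?P ({..<n} - S))"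
    by (simp add: card_Un_disjoint)
  moreover have "card ({..<n} - S) = n - card S"
    using S by (simp add: card_Diff_subset finite_subset)
  ultimately show ?thesis
    using card_ordered_pairs[of "{..<n}"] card_ordered_pairs[of "{..<n} - S"] by simp
qed

text \<open>A smaller \<open>S\<close> leaves a larger complementary triangle. One exponent thus
  serves all index sets with at most \<open>r\<close> elements.\<close>

lemma card_upper_pairs_mono:
  assumes "S \<subseteq> {..<n}" "card S \<le> r" "r \<le> n"
  shows "card (upper_pairs n S) \<le> card (upper_pairs n {..<r})"
proof -
  have "(n - r) * (n - r + 1) \<le> (n - card S) * (n - card S + 1)"
    using assms by (intro mult_le_mono) auto
  moreover have "2 * card (upper_pairs n {..<r}) + (n - r) * (n - r + 1) = n * (n + 1)"
    using card_upper_pairs[of "{..<r}" n] assms(3) by (metis card_lessThan lessThan_subset_iff)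
  ultimately show ?thesis
    using card_upper_pairs[OF assms(1)] by linarith
qed

context finite_field
begin

section \<open>Symmetric matrices as a finite vector space\<close>

lemma sym_carrier_iff:
  "A \<in> carrier (sym_space R n) \<longleftrightarrow>
     A \<in> {..<n} \<times> {..<n} \<rightarrow>\<^sub>E carrier R \<and> (\<forall>i<n. \<forall>j<n. A (i, j) = A (j, i))"
  by (auto simp: sym_space_def func_space_def)

lemma zero_sym_space: "\<zero>\<^bsub>sym_space R n\<^esub> = (\<lambda>_\<in>{..<n} \<times> {..<n}. \<zero>)"
  by (simp add: sym_space_def func_space_def)

lemma smult_sym_space: "a \<odot>\<^bsub>sym_space R n\<^esub> A = (\<lambda>p\<in>{..<n} \<times> {..<n}. a \<otimes> A p)"
  by (simp add: sym_space_def func_space_def)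

lemma finite_sym_space: "finite (carrier (sym_space R n))"
  by (rule finite_subset[of _ "{..<n} \<times> {..<n} \<rightarrow>\<^sub>E carrier R"])
     (auto simp: sym_space_def func_space_def finite_carrier intro: finite_PiE)

lemma sym_space_finite_vectorspace: "finite_vectorspace R (sym_space R n)"
proof -
  interpret vectorspace R "sym_space R n"
    by (rule sym_space_is_vectorspace) unfold_locales
  show ?thesis
    by unfold_locales (auto simp: finite_carrier finite_sym_space)
qed

text \<open>The upper triangle is free; the inverse map reflects it across the diagonal through
  \<open>(min i j, max i j)\<close>.\<close>

lemma card_sym_space: "card (carrier (sym_space R n)) = card (carrier R) ^ card (upper_pairs n {..<n})"
proof -
  let ?P = "upper_pairs n {..<n}"
  have "bij_betw (\<lambda>A. restrict A ?P) (carrier (sym_space R n)) (?P \<rightarrow>\<^sub>E carrier R)"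
  proof (rule bij_betw_byWitness[where
        f' = "\<lambda>f. (\<lambda>(i, j)\<in>{..<n} \<times> {..<n}. f (min i j, max i j))"])
    show "\<forall>A\<in>carrier (sym_space R n).
        (\<lambda>(i, j)\<in>{..<n} \<times> {..<n}. restrict A ?P (min i j, max i j)) = A"
      by (auto simp: sym_carrier_iff fun_eq_iff upper_pairs_def min_def max_def PiE_def extensional_def)
    show "\<forall>f\<in>?P \<rightarrow>\<^sub>E carrier R.
        restrict (\<lambda>(i, j)\<in>{..<n} \<times> {..<n}. f (min i j, max i j)) ?P = f"
      by (auto simp: fun_eq_iff upper_pairs_def PiE_def extensional_def restrict_def)
    show "(\<lambda>A. restrict A ?P) ` carrier (sym_space R n) \<subseteq> ?P \<rightarrow>\<^sub>E carrier R"
      using upper_pairs_subset[of n "{..<n}"] by (fastforce simp: sym_carrier_iff)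
    show "(\<lambda>f. (\<lambda>(i, j)\<in>{..<n} \<times> {..<n}. f (min i j, max i j))) ` (?P \<rightarrow>\<^sub>E carrier R)
        \<subseteq> carrier (sym_space R n)"
      by (auto simp: sym_carrier_iff upper_pairs_def min_def max_def PiE_def Pi_def extensional_def)
  qed
  then show ?thesis
    by (simp add: bij_betw_same_card card_funcsetE)
qed

text \<open>Zero is left out since every subspace contains it. The subspaces counted by the density
  become those disjoint from \<open>low_rank n (d - 1)\<close>.\<close>

definition low_rank :: "nat \<Rightarrow> nat \<Rightarrow> (nat \<times> nat \<Rightarrow> 'a) set" where
  "low_rank n r = {A \<in> carrier (sym_space R n) - {\<zero>\<^bsub>sym_space R n\<^esub>}. matrix_rank R n A \<le> r}"

lemma finite_low_rank: "finite (low_rank n r)"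
  using finite_sym_space by (simp add: low_rank_def)

text \<open>Supplies the closure under scaling that the union bound over lines asks for. The column
  relations of \<open>A\<close> hold for a multiple of \<open>A\<close> with the same
  coefficients.\<close>

lemma low_rank_smult:
  assumes a: "a \<in> carrier R" "a \<noteq> \<zero>" and A: "A \<in> low_rank n r"
  shows "a \<odot>\<^bsub>sym_space R n\<^esub> A \<in> low_rank n r"
proof -
  let ?B = "a \<odot>\<^bsub>sym_space R n\<^esub> A"
  interpret V: vectorspace R "sym_space R n"
    by (rule sym_space_is_vectorspace) unfold_locales
  have A1: "A \<in> carrier (sym_space R n)" "A \<noteq> \<zero>\<^bsub>sym_space R n\<^esub>" "matrix_rank R n A \<le> r"
    using A by (auto simp: low_rank_def)
  then have A2: "A \<in> carrier (matrix_space R n)"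
    by (auto simp: sym_space_def)
  have A3: "A (i, j) \<in> carrier R" if "i < n" "j < n" for i j
    using A1(1) that by (auto simp: sym_carrier_iff)
  have B: "?B \<in> carrier (sym_space R n)"
    using a A1 by simp
  then have B2: "?B \<in> carrier (matrix_space R n)"
    by (auto simp: sym_space_def)
  have "?B \<noteq> \<zero>\<^bsub>sym_space R n\<^esub>"
  proof
    assume "?B = \<zero>\<^bsub>sym_space R n\<^esub>"
    then have "A = inv a \<odot>\<^bsub>sym_space R n\<^esub> \<zero>\<^bsub>sym_space R n\<^esub>"
      using V.mult_inverse[OF a(1) A1(1)] a(2) by blast
    moreover have "inv a \<in> carrier R" using a field_Units by auto
    ultimately show False using A1(2) by simp
  qed
  moreover obtain S c where S: "S \<subseteq> {..<n}" "card S = matrix_rank R n A"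
    "c \<in> S \<times> {..<n} \<rightarrow> carrier R"
    "\<forall>i<n. \<forall>j<n. A (i, j) = (\<Oplus>s\<in>S. c (s, j) \<otimes> A (i, s))"
    using matrix_rank_witness[OF A2] .
  have "matrix_rank R n ?B \<le> card S"
  proof (rule matrix_rank_le[OF B2, where c = c and l = "\<lambda>(i, s). a \<otimes> A (i, s)"])
    show "finite S" using S(1) finite_subset by blast
    show "(\<lambda>(i, s). a \<otimes> A (i, s)) \<in> {..<n} \<times> S \<rightarrow> carrier R"
      using A3 S(1) a by auto
    fix i j assume i: "i < n" and j: "j < n"
    have cl: "c (s, j) \<in> carrier R" "A (i, s) \<in> carrier R" if "s \<in> S" for s
      using that S(1,3) i j A3 by auto
    have "?B (i, j) = a \<otimes> (\<Oplus>s\<in>S. c (s, j) \<otimes> A (i, s))"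
      using i j S(4) by (simp add: smult_sym_space)
    also have "\<dots> = (\<Oplus>s\<in>S. a \<otimes> (c (s, j) \<otimes> A (i, s)))"
      using \<open>finite S\<close> a cl by (intro finsum_rdistr) auto
    also have "\<dots> = (\<Oplus>s\<in>S. c (s, j) \<otimes> (a \<otimes> A (i, s)))"
      using a cl by (intro finsum_cong') (auto simp: m_lcomm)
    finally show "?B (i, j) = (\<Oplus>s\<in>S. c (s, j) \<otimes> (case (i, s) of (i, s) \<Rightarrow> a \<otimes> A (i, s)))"
      by simp
  qed (use S in auto)
  ultimately show ?thesis
    using B A1(3) S(2) by (simp add: low_rank_def)
qed

text \<open>By symmetry the rows satisfy the same relations as the columns, so \<open>A (i, j)\<close> and \<open>B (i, j)\<close>
  both equal the sum of \<open>c (t, i) d (s, j) A (s, t)\<close> over \<open>s, t\<close> in \<open>S\<close>.\<close>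
lemma sym_eq_if_eq_upper_pairs:
  assumes A: "A \<in> carrier (sym_space R n)" and B: "B \<in> carrier (sym_space R n)"
    and S: "S \<subseteq> {..<n}"
    and c: "c \<in> S \<times> {..<n} \<rightarrow> carrier R" and d: "d \<in> S \<times> {..<n} \<rightarrow> carrier R"
    and Ac: "\<And>i j. i < n \<Longrightarrow> j < n \<Longrightarrow> A (i, j) = (\<Oplus>s\<in>S. c (s, j) \<otimes> A (i, s))"
    and Bd: "\<And>i j. i < n \<Longrightarrow> j < n \<Longrightarrow> B (i, j) = (\<Oplus>s\<in>S. d (s, j) \<otimes> B (i, s))"
    and eq: "\<And>p. p \<in> upper_pairs n S \<Longrightarrow> A p = B p"
  shows "A = B"
proof (rule PiE_ext[of A "{..<n} \<times> {..<n}" "\<lambda>_. carrier R"])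
  fix p assume "p \<in> {..<n} \<times> {..<n}"
  then obtain i j where p: "p = (i, j)" "i < n" "j < n" by auto
  have symA: "A (i, j) = A (j, i)" and symB: "B (i, j) = B (j, i)" if "i < n" "j < n" for i j
    using A B that by (auto simp: sym_carrier_iff)
  have cA: "A (i, j) \<in> carrier R" and cB: "B (i, j) \<in> carrier R" if "i < n" "j < n" for i j
    using A B that by (auto simp: sym_carrier_iff)
  have fS: "finite S" using S finite_subset by blast
  have AB: "A (i, s) = B (i, s)" if "i < n" "s \<in> S" for i s
  proof (cases "i \<le> s")
    case True
    then show ?thesis using eq[of "(i, s)"] that S by (auto simp: upper_pairs_def)
  next
    case False
    then have "A (s, i) = B (s, i)" using eq[of "(s, i)"] that S by (auto simp: upper_pairs_def)
    then show ?thesis using symA symB that S by auto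
  qed
  have cl: "c (s, i) \<in> carrier R" "d (s, j) \<in> carrier R" if "s \<in> S" for s
    using that c d p by auto
  have lt: "s < n" if "s \<in> S" for s using that S by auto
  note cls = cl lt cA cB p(2,3)
  have "B (i, j) = (\<Oplus>s\<in>S. d (s, j) \<otimes> B (i, s))"
    using Bd p by simp
  \<comment> \<open>For \<open>s\<close> in \<open>S\<close>, \<open>B (i, s)\<close> equals
    \<open>A (s, i)\<close>, which the column relation of \<open>A\<close> expands.\<close>
  also have "\<dots> = (\<Oplus>s\<in>S. d (s, j) \<otimes> (\<Oplus>t\<in>S. c (t, i) \<otimes> A (s, t)))"
    using cls by (intro finsum_cong') (auto simp: AB[symmetric] symA[of i] Ac[symmetric])
  also have "\<dots> = (\<Oplus>s\<in>S. \<Oplus>t\<in>S. d (s, j) \<otimes> (c (t, i) \<otimes> A (s, t)))"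
    using cls fS by (intro finsum_cong' finsum_rdistr) (auto intro!: finsum_closed)
  also have "\<dots> = (\<Oplus>t\<in>S. \<Oplus>s\<in>S. d (s, j) \<otimes> (c (t, i) \<otimes> A (s, t)))"
    using cls fS by (intro finsum_finsum_swap) auto
  \<comment> \<open>Regrouped with \<open>A (s, t) = B (t, s)\<close>, the inner sum becomes the
    column relation of \<open>B\<close> and collapses to \<open>B (t, j)\<close>, that is, to
    \<open>A (j, t)\<close>.\<close>
  also have "\<dots> = (\<Oplus>t\<in>S. c (t, i) \<otimes> (\<Oplus>s\<in>S. d (s, j) \<otimes> B (t, s)))"
  proof (rule finsum_cong')
    fix t assume t: "t \<in> S"
    have "c (t, i) \<otimes> (\<Oplus>s\<in>S. d (s, j) \<otimes> B (t, s)) = (\<Oplus>s\<in>S. c (t, i) \<otimes> (d (s, j) \<otimes> B (t, s)))"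
      using cls fS t by (intro finsum_rdistr) auto
    also have "\<dots> = (\<Oplus>s\<in>S. d (s, j) \<otimes> (c (t, i) \<otimes> A (s, t)))"
      using cls t by (intro finsum_cong') (auto simp: AB symB[of t] intro!: m_lcomm)
    finally show "(\<Oplus>s\<in>S. d (s, j) \<otimes> (c (t, i) \<otimes> A (s, t))) =
        c (t, i) \<otimes> (\<Oplus>s\<in>S. d (s, j) \<otimes> B (t, s))" by simp
  qed (use cls in \<open>auto intro!: m_closed finsum_closed\<close>)
  also have "\<dots> = (\<Oplus>t\<in>S. c (t, i) \<otimes> A (j, t))"
    using cls by (intro finsum_cong') (auto simp: Bd[symmetric] AB symB[of j])
  also have "\<dots> = A (i, j)"
    using Ac p symA by simp
  finally show "A p = B p" by (simp add: p)
qed (use A B in \<open>auto simp: sym_carrier_iff\<close>)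

text \<open>Every matrix in \<open>low_rank n r\<close> belongs to \<open>?D S\<close> for some
  \<open>S\<close> with at most \<open>r\<close> elements, and on \<open>?D S\<close> restriction to
  \<open>upper_pairs n S\<close> is injective. The factor \<open>2 ^ n\<close> bounds the number of
  sets \<open>S\<close>.\<close>

lemma card_low_rank_le:
  assumes "r \<le> n"
  shows "card (low_rank n r) \<le> 2 ^ n * card (carrier R) ^ card (upper_pairs n {..<r})"
proof -
  let ?q = "card (carrier R)"
  have q: "?q \<ge> 1"
    using card_gt_0_iff[of "carrier R"] finite_carrier one_closed by fastforce
  let ?D = "\<lambda>S. {A \<in> carrier (sym_space R n). \<exists>c \<in> S \<times> {..<n} \<rightarrow> carrier R.
      \<forall>i<n. \<forall>j<n. A (i, j) = (\<Oplus>s\<in>S. c (s, j) \<otimes> A (i, s))}"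
  let ?I = "{S. S \<subseteq> {..<n} \<and> card S \<le> r}"
  have "low_rank n r \<subseteq> (\<Union>S\<in>?I. ?D S)"
  proof
    fix A assume A: "A \<in> low_rank n r"
    then have A': "A \<in> carrier (matrix_space R n)"
      by (auto simp: low_rank_def sym_space_def)
    obtain S c where S: "S \<subseteq> {..<n}" "card S = matrix_rank R n A"
      "c \<in> S \<times> {..<n} \<rightarrow> carrier R"
      "\<forall>i<n. \<forall>j<n. A (i, j) = (\<Oplus>s\<in>S. c (s, j) \<otimes> A (i, s))"
      using matrix_rank_witness[OF A'] .
    then have "A \<in> ?D S" "S \<in> ?I" using A by (auto simp: low_rank_def)
    then show "A \<in> (\<Union>S\<in>?I. ?D S)" by blast
  qed
  moreover have "finite (\<Union>S\<in>?I. ?D S)"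
    by (rule finite_subset[OF _ finite_sym_space[of n]]) auto
  ultimately have "card (low_rank n r) \<le> card (\<Union>S\<in>?I. ?D S)"
    by (simp add: card_mono)
  also have "\<dots> \<le> (\<Sum>S\<in>?I. card (?D S))"
    by (rule card_UN_le) simp
  also have "\<dots> \<le> (\<Sum>S\<in>?I. ?q ^ card (upper_pairs n {..<r}))"
  proof (rule sum_mono)
    fix S assume S: "S \<in> ?I"
    have "inj_on (\<lambda>A. restrict A (upper_pairs n S)) (?D S)"
    proof (rule inj_onI)
      fix A B assume A: "A \<in> ?D S" and B: "B \<in> ?D S"
        and eq: "restrict A (upper_pairs n S) = restrict B (upper_pairs n S)"
      have eq': "A p = B p" if "p \<in> upper_pairs n S" for p
        using fun_cong[OF eq, of p] that by simp
      from A obtain c where c: "c \<in> S \<times> {..<n} \<rightarrow> carrier R"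
          "\<forall>i<n. \<forall>j<n. A (i, j) = (\<Oplus>s\<in>S. c (s, j) \<otimes> A (i, s))" by blast
      from B obtain d where d: "d \<in> S \<times> {..<n} \<rightarrow> carrier R"
          "\<forall>i<n. \<forall>j<n. B (i, j) = (\<Oplus>s\<in>S. d (s, j) \<otimes> B (i, s))" by blast
      show "A = B"
        using A B S c(2) d(2) eq' by (intro sym_eq_if_eq_upper_pairs[OF _ _ _ c(1) d(1)]) auto
    qed
    moreover have "(\<lambda>A. restrict A (upper_pairs n S)) ` ?D S \<subseteq> upper_pairs n S \<rightarrow>\<^sub>E carrier R"
      using upper_pairs_subset[of n S] by (fastforce simp: sym_carrier_iff)
    ultimately have "card (?D S) \<le> card (upper_pairs n S \<rightarrow>\<^sub>E carrier R)"
      by (rule card_inj_on_le) (simp add: finite_PiE finite_carrier)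
    also have "\<dots> = ?q ^ card (upper_pairs n S)"
      by (simp add: card_funcsetE)
    also have "\<dots> \<le> ?q ^ card (upper_pairs n {..<r})"
      using S assms q by (intro power_increasing card_upper_pairs_mono) auto
    finally show "card (?D S) \<le> ?q ^ card (upper_pairs n {..<r})" .
  qed
  also have "\<dots> \<le> 2 ^ n * ?q ^ card (upper_pairs n {..<r})"
  proof -
    have "card ?I \<le> card (Pow {..<n})" by (intro card_mono) auto
    then show ?thesis by (simp add: card_Pow)
  qed
  finally show ?thesis .
qed

text \<open>Coordinates on the symmetric matrices of rank at most \<open>r\<close> that admit an \<open>LDL\<^sup>T\<close>
  decomposition: \<open>U\<close> holds the first \<open>r\<close> rows of \<open>DL\<^sup>T\<close>.\<close>
definition ldl_domain :: "nat \<Rightarrow> nat \<Rightarrow> (nat \<times> nat \<Rightarrow> 'a) set" where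
  "ldl_domain n r = (\<Pi>\<^sub>E (t, j)\<in>upper_pairs n {..<r}. if t = j then carrier R - {\<zero>} else carrier R)"

text \<open>The triangular factor, continued by zero to the left of the diagonal;
  \<open>ldl_entry U t t\<close> is the \<open>t\<close>-th pivot.\<close>

definition ldl_entry :: "(nat \<times> nat \<Rightarrow> 'a) \<Rightarrow> nat \<Rightarrow> nat \<Rightarrow> 'a" where
  "ldl_entry U t j = (if t \<le> j then U (t, j) else \<zero>)"

text \<open>With \<open>D\<close> the diagonal of pivots and \<open>U\<close> equal to
  \<open>D\<close> times the transpose of \<open>L\<close>, the product is the sum of
  \<open>r\<close> rank-one terms, each divided by its pivot. Only pivots are inverted, so
  characteristic 2 is covered too.\<close>

definition ldl_matrix :: "nat \<Rightarrow> nat \<Rightarrow> (nat \<times> nat \<Rightarrow> 'a) \<Rightarrow> nat \<times> nat \<Rightarrow> 'a" where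
  "ldl_matrix n r U = (\<lambda>(i, j)\<in>{..<n} \<times> {..<n}.
     \<Oplus>t\<in>{..<r}. (inv (ldl_entry U t t) \<otimes> ldl_entry U t j) \<otimes> ldl_entry U t i)"

lemma ldl_entry_closed:
  assumes "U \<in> ldl_domain n r" "t < r" "j < n"
  shows "ldl_entry U t j \<in> carrier R"
  using assms PiE_mem[of U "upper_pairs n {..<r}" _ "(t, j)"]
  by (auto simp: ldl_domain_def ldl_entry_def upper_pairs_def split: if_splits)

lemma ldl_entry_diag:
  assumes "U \<in> ldl_domain n r" "t < r" "r \<le> n"
  shows "ldl_entry U t t \<in> carrier R" "ldl_entry U t t \<noteq> \<zero>" "inv (ldl_entry U t t) \<in> carrier R"
proof -
  have "ldl_entry U t t \<in> carrier R - {\<zero>}"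
    using assms PiE_mem[OF assms(1)[unfolded ldl_domain_def], of "(t, t)"]
    by (auto simp: ldl_entry_def upper_pairs_def)
  then show "ldl_entry U t t \<in> carrier R" "ldl_entry U t t \<noteq> \<zero>" "inv (ldl_entry U t t) \<in> carrier R"
    using field_Units Units_inv_closed by auto
qed

text \<open>Terms with \<open>s > t\<close> vanish since the factor is triangular, and in the term
  \<open>s = t\<close> the pivot cancels. Row \<open>t\<close> of \<open>U\<close> can thus be
  recovered from the matrix and the earlier rows.\<close>

lemma ldl_matrix_row:
  assumes U: "U \<in> ldl_domain n r" and t: "t < r" and j: "j < n" and r: "r \<le> n"
  shows "ldl_matrix n r U (t, j) = ldl_entry U t j \<oplus>
    (\<Oplus>s\<in>{..<t}. (inv (ldl_entry U s s) \<otimes> ldl_entry U s j) \<otimes> ldl_entry U s t)"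
proof -
  let ?u = "ldl_entry U"
  let ?g = "\<lambda>s. (inv (?u s s) \<otimes> ?u s j) \<otimes> ?u s t"
  have tn: "t < n" using t r by simp
  have cl: "?u s j \<in> carrier R" "?u s t \<in> carrier R" "inv (?u s s) \<in> carrier R" "?u s s \<in> carrier R"
    if "s < r" for s
    using that U j tn r ldl_entry_closed ldl_entry_diag by auto
  have "ldl_matrix n r U (t, j) = (\<Oplus>s\<in>{..<r}. ?g s)"
    using tn j by (simp add: ldl_matrix_def)
  also have "\<dots> = (\<Oplus>s\<in>insert t {..<t}. ?g s)"
  proof (rule add.finprod_mono_neutral_cong_right)
    fix s assume "s \<in> {..<r} - insert t {..<t}"
    then show "?g s = \<zero>" using cl by (auto simp: ldl_entry_def)
  qed (use t cl in auto)
  also have "\<dots> = ?g t \<oplus> (\<Oplus>s\<in>{..<t}. ?g s)"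
    using t cl by (intro add.finprod_insert) auto
  also have "?g t = ?u t j"
  proof -
    have "?g t = (inv (?u t t) \<otimes> ?u t t) \<otimes> ?u t j"
      using cl[OF t] by (simp add: m_ac)
    then show ?thesis
      using cl[OF t] ldl_entry_diag[OF U t r] field_Units by simp
  qed
  finally show ?thesis .
qed

text \<open>The formula is a factorisation through \<open>{..<r}\<close>, which bounds the rank. The
  entry at \<open>(0, 0)\<close> is the first pivot, so the matrix is not zero.\<close>

lemma ldl_matrix_in_low_rank:
  assumes U: "U \<in> ldl_domain n r" and r: "1 \<le> r" "r \<le> n"
  shows "ldl_matrix n r U \<in> low_rank n r"
proof -
  let ?u = "ldl_entry U" and ?A = "ldl_matrix n r U"
  have cl: "?u s j \<in> carrier R" "inv (?u s s) \<in> carrier R" if "s < r" "j < n" for s j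
    using that U r ldl_entry_closed ldl_entry_diag by auto
  have "?A (i, j) \<in> carrier R" if "i < n" "j < n" for i j
    using that cl by (auto simp: ldl_matrix_def intro!: finsum_closed m_closed)
  moreover have "?A (i, j) = ?A (j, i)" if "i < n" "j < n" for i j
    using that cl by (auto simp: ldl_matrix_def m_ac intro!: finsum_cong')
  moreover have "?A \<in> extensional ({..<n} \<times> {..<n})"
    by (simp add: ldl_matrix_def)
  ultimately have A: "?A \<in> carrier (sym_space R n)"
    by (auto simp: sym_carrier_iff PiE_def)
  have "?A (0, 0) = ?u 0 0"
    using ldl_matrix_row[OF U, of 0 0] r ldl_entry_diag[OF U, of 0] by simp
  then have "?A (0, 0) \<noteq> \<zero>"
    using ldl_entry_diag[OF U, of 0] r by simp
  then have "?A \<noteq> \<zero>\<^bsub>sym_space R n\<^esub>"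
    using r by (auto simp: zero_sym_space)
  moreover have "matrix_rank R n ?A \<le> card {..<r}"
  proof (rule matrix_rank_le[where c = "\<lambda>(t, j). inv (?u t t) \<otimes> ?u t j" and l = "\<lambda>(i, t). ?u t i"])
    show "?A \<in> carrier (matrix_space R n)" using A by (auto simp: sym_space_def)
  qed (use cl in \<open>auto simp: ldl_matrix_def\<close>)
  ultimately show ?thesis
    using A by (simp add: low_rank_def)
qed

text \<open>Induction on the row: once the earlier rows agree, the sums in
  \<open>ldl_matrix_row\<close> agree and cancel.\<close>

lemma inj_on_ldl_matrix:
  assumes r: "r \<le> n"
  shows "inj_on (ldl_matrix n r) (ldl_domain n r)"
proof (rule inj_onI)
  fix U U' assume U: "U \<in> ldl_domain n r" and U': "U' \<in> ldl_domain n r"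
    and eq: "ldl_matrix n r U = ldl_matrix n r U'"
  have *: "\<forall>j<n. ldl_entry U t j = ldl_entry U' t j" if "t < r" for t
    using that
  proof (induction t rule: less_induct)
    case (less t)
    show ?case
    proof (intro allI impI)
      fix j assume j: "j < n"
      let ?g = "\<lambda>U s. (inv (ldl_entry U s s) \<otimes> ldl_entry U s j) \<otimes> ldl_entry U s t"
      have cl: "ldl_entry U s i \<in> carrier R" "ldl_entry U' s i \<in> carrier R"
        "inv (ldl_entry U s s) \<in> carrier R" "inv (ldl_entry U' s s) \<in> carrier R"
        if "s < r" "i < n" for s i
        using that U U' r ldl_entry_closed ldl_entry_diag by auto
      have gU': "?g U' \<in> {..<t} \<rightarrow> carrier R"
        using less.prems r j by (auto intro!: m_closed cl)
      have sums: "(\<Oplus>s\<in>{..<t}. ?g U s) = (\<Oplus>s\<in>{..<t}. ?g U' s)"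
        using less.IH less.prems r j by (intro finsum_cong' refl gU') auto
      have "ldl_entry U t j \<oplus> (\<Oplus>s\<in>{..<t}. ?g U' s) = ldl_entry U' t j \<oplus> (\<Oplus>s\<in>{..<t}. ?g U' s)"
        using ldl_matrix_row[OF U less.prems j r] ldl_matrix_row[OF U' less.prems j r] eq sums by simp
      then show "ldl_entry U t j = ldl_entry U' t j"
        using cl[OF less.prems j] finsum_closed[OF gU'] by simp
    qed
  qed
  show "U = U'"
  proof (rule PiE_ext[OF U[unfolded ldl_domain_def] U'[unfolded ldl_domain_def]])
    fix p assume "p \<in> upper_pairs n {..<r}"
    then obtain t j where "p = (t, j)" "t < r" "t \<le> j" "j < n"
      by (auto simp: upper_pairs_def)
    then show "U p = U' p" using *[of t] by (auto simp: ldl_entry_def)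
  qed
qed

lemma card_carrier_ge_2: "2 \<le> card (carrier R)"
proof -
  have "card {\<zero>, \<one>} \<le> card (carrier R)"
    by (intro card_mono finite_carrier) auto
  then show ?thesis by simp
qed

text \<open>Each coordinate of the parametrisation has at least \<open>q - 1\<close> values, and
  \<open>q - 1\<close> is at least \<open>q / 2\<close>.\<close>

lemma card_low_rank_ge:
  assumes r: "1 \<le> r" "r \<le> n"
  shows "(real (card (carrier R)) / 2) ^ card (upper_pairs n {..<r}) \<le> real (card (low_rank n r))"
proof -
  let ?q = "card (carrier R)" and ?P = "upper_pairs n {..<r}"
  have "(real ?q / 2) ^ card ?P = (\<Prod>p\<in>?P. real ?q / 2)" by simp
  also have "\<dots> \<le> (\<Prod>p\<in>?P. real (card (case p of (t, j) \<Rightarrow> if t = j then carrier R - {\<zero>} else carrier R)))"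
    using card_carrier_ge_2 finite_carrier
    by (intro prod_mono) (auto simp: card_Diff_singleton of_nat_diff)
  also have "\<dots> = real (card (ldl_domain n r))"
    by (simp add: ldl_domain_def card_PiE)
  also have "card (ldl_domain n r) \<le> card (low_rank n r)"
    using ldl_matrix_in_low_rank r
    by (intro card_inj_on_le[OF inj_on_ldl_matrix] finite_low_rank) auto
  finally show ?thesis by simp
qed

section \<open>Two-sided bounds for the density over one finite field\<close>

lemma sym_density_eq:
  fixes n k d :: nat
  assumes "1 \<le> d"
  defines "S \<equiv> finite_vectorspace.superspaces R (sym_space R n) {\<zero>\<^bsub>sym_space R n\<^esub>} k"
  shows "sym_density R n k d = real (card {W \<in> S. W \<inter> low_rank n (d - 1) = {}}) / real (card S)"
proof -
  interpret V: finite_vectorspace R "sym_space R n"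
    by (rule sym_space_finite_vectorspace)
  \<comment> \<open>A subspace of dimension \<open>e\<close> has \<open>q ^ e\<close> elements, and
    \<open>q \<ge> 2\<close> makes this injective in \<open>e\<close>.\<close>
  have "vectorspace.dim R (sym_space R n\<lparr>carrier := W\<rparr>) = k \<longleftrightarrow> card W = card (carrier R) ^ k"
    if W: "VectorSpace.subspace R W (sym_space R n)" for W
  proof -
    interpret W: vectorspace R "sym_space R n\<lparr>carrier := W\<rparr>"
      using W by (rule V.subspace_is_vs)
    have "card W = card (carrier R) ^ W.dim"
      using W.card_carrier_eq_power_dim V.subspaceD(3)[OF W] by simp
    then show ?thesis
      using card_carrier_ge_2 by auto
  qed
  then have S: "subspaces_of_dim R (sym_space R n) k = S"
    unfolding subspaces_of_dim_def S_def V.superspaces_def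
    using V.subspaceD(2) by auto
  \<comment> \<open>Since \<open>d \<ge> 1\<close>, failing to have rank at least \<open>d\<close>
    means having rank at most \<open>d - 1\<close>.\<close>
  have "(\<forall>A\<in>W. A \<noteq> \<zero>\<^bsub>sym_space R n\<^esub> \<longrightarrow> d \<le> matrix_rank R n A) \<longleftrightarrow> W \<inter> low_rank n (d - 1) = {}"
    if "W \<in> S" for W
  proof -
    have "W \<subseteq> carrier (sym_space R n)"
      using that V.subspaceD(1) by (auto simp: S_def V.superspaces_def)
    then show ?thesis
      using \<open>1 \<le> d\<close> by (fastforce simp: low_rank_def)
  qed
  then have "{W \<in> S. \<forall>A\<in>W. A \<noteq> \<zero>\<^bsub>sym_space R n\<^esub> \<longrightarrow> d \<le> matrix_rank R n A} =
      {W \<in> S. W \<inter> low_rank n (d - 1) = {}}"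
    by blast
  then show ?thesis
    by (simp add: sym_density_def S)
qed

text \<open>The Chebyshev bound with at least \<open>(q / 2) ^ m\<close> low-rank matrices; the last
  factor 2 of the constant comes from \<open>q ^ k - 1 \<ge> q ^ k / 2\<close>. \<open>N\<close> is
  the dimension of the space.\<close>

lemma sym_density_le:
  fixes n k d :: nat
  assumes "2 \<le> d" "d \<le> n" "1 \<le> k"
  defines "q \<equiv> real (card (carrier R))"
    and "N \<equiv> card (upper_pairs n {..<n})" and "m \<equiv> card (upper_pairs n {..<d - 1})"
  assumes "k \<le> N"
  shows "sym_density R n k d \<le> 2 ^ (m + 1) * (q ^ (N + 1) / q ^ (m + k))"
proof -
  interpret V: finite_vectorspace R "sym_space R n"
    by (rule sym_space_finite_vectorspace)
  define S where "S = V.superspaces {\<zero>\<^bsub>sym_space R n\<^esub>} k"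
  define G0 where "G0 = real (card {W \<in> S. W \<inter> low_rank n (d - 1) = {}})"
  define b where "b = real (card (low_rank n (d - 1)))"
  have q: "q \<ge> 2" using card_carrier_ge_2 by (simp add: q_def)
  have Q: "real (card (carrier (sym_space R n))) = q ^ N"
    by (simp add: card_sym_space q_def N_def)
  have le: "card (carrier R) ^ k \<le> card (carrier (sym_space R n))"
    using card_carrier_ge_2 \<open>k \<le> N\<close> by (simp add: card_sym_space N_def power_increasing)
  have G: "real (card S) > 0"
    using V.card_superspaces_pos[OF le] by (simp add: S_def)
  have b: "(q / 2) ^ m \<le> b"
    unfolding q_def m_def b_def using assms by (intro card_low_rank_ge) auto
  have "low_rank n (d - 1) \<subseteq> carrier (sym_space R n) - {\<zero>\<^bsub>sym_space R n\<^esub>}"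
    by (auto simp: low_rank_def)
  from V.card_superspaces_avoiding_le[OF this \<open>1 \<le> k\<close> le]
  have *: "G0 * (b * (q ^ k - 1)) \<le> card S * ((q - 1) * (q ^ N - 1))"
    by (simp add: G0_def b_def S_def Q flip: q_def)
  have "q ^ k \<ge> q ^ 1"
    using q \<open>1 \<le> k\<close> by (intro power_increasing) auto
  then have "q ^ k / 2 \<le> q ^ k - 1" using q by simp
  then have "(q / 2) ^ m * (q ^ k / 2) \<le> b * (q ^ k - 1)"
    using b q by (intro mult_mono) (auto intro: order_trans[OF _ b])
  then have "G0 * ((q / 2) ^ m * (q ^ k / 2)) \<le> G0 * (b * (q ^ k - 1))"
    by (intro mult_left_mono) (auto simp: G0_def)
  also note *
  also have "card S * ((q - 1) * (q ^ N - 1)) \<le> card S * (q * q ^ N)"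
    using q by (intro mult_left_mono mult_mono) auto
  finally have "G0 * (q ^ (m + k) / 2 ^ (m + 1)) \<le> card S * q ^ (N + 1)"
    by (simp add: power_divide power_add)
  then have "G0 / card S \<le> 2 ^ (m + 1) * (q ^ (N + 1) / q ^ (m + k))"
    using G q by (simp add: divide_simps mult_ac)
  then show ?thesis
    using sym_density_eq[of d n k] assms(1) by (simp add: G0_def S_def)
qed

text \<open>The union bound with at most \<open>2 ^ n * q ^ m\<close> low-rank matrices; halving
  both \<open>q\<close> and \<open>q ^ N\<close> to absorb the subtracted ones costs the factor
  4.\<close>

lemma sym_density_ge:
  fixes n k d :: nat
  assumes "2 \<le> d" "d \<le> n" "1 \<le> k"
  defines "q \<equiv> real (card (carrier R))"
    and "N \<equiv> card (upper_pairs n {..<n})" and "m \<equiv> card (upper_pairs n {..<d - 1})"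
  assumes "k \<le> N"
  shows "1 - 2 ^ (n + 2) * (q ^ (m + k) / q ^ (N + 1)) \<le> sym_density R n k d"
proof -
  interpret V: finite_vectorspace R "sym_space R n"
    by (rule sym_space_finite_vectorspace)
  define S where "S = V.superspaces {\<zero>\<^bsub>sym_space R n\<^esub>} k"
  define G0 where "G0 = real (card {W \<in> S. W \<inter> low_rank n (d - 1) = {}})"
  define G1 where "G1 = real (card {W \<in> S. W \<inter> low_rank n (d - 1) \<noteq> {}})"
  define b where "b = real (card (low_rank n (d - 1)))"
  have q: "q \<ge> 2" using card_carrier_ge_2 by (simp add: q_def)
  have Q: "real (card (carrier (sym_space R n))) = q ^ N"
    by (simp add: card_sym_space q_def N_def)
  have le: "card (carrier R) ^ k \<le> card (carrier (sym_space R n))"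
    using card_carrier_ge_2 \<open>k \<le> N\<close> by (simp add: card_sym_space N_def power_increasing)
  have G: "real (card S) > 0"
    using V.card_superspaces_pos[OF le] by (simp add: S_def)
  have "S = {W \<in> S. W \<inter> low_rank n (d - 1) = {}} \<union> {W \<in> S. W \<inter> low_rank n (d - 1) \<noteq> {}}"
    by blast
  also have "card \<dots> = card {W \<in> S. W \<inter> low_rank n (d - 1) = {}} + card {W \<in> S. W \<inter> low_rank n (d - 1) \<noteq> {}}"
    by (rule card_Un_disjoint) (auto simp: S_def)
  finally have sum: "real (card S) = G0 + G1"
    by (simp add: G0_def G1_def)
  have "b \<le> real (2 ^ n * card (carrier R) ^ m)"
    unfolding b_def m_def using assms by (intro of_nat_mono card_low_rank_le) auto
  then have b: "b \<le> 2 ^ n * q ^ m" by (simp add: q_def)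
  have "low_rank n (d - 1) \<subseteq> carrier (sym_space R n) - {\<zero>\<^bsub>sym_space R n\<^esub>}"
    by (auto simp: low_rank_def)
  from V.card_superspaces_meeting_le[OF this low_rank_smult \<open>1 \<le> k\<close>]
  have *: "G1 * ((q - 1) * (q ^ N - 1)) \<le> card S * (b * (q ^ k - 1))"
    by (simp add: G1_def b_def S_def Q flip: q_def)
  have "q ^ N \<ge> q ^ 1"
    using q \<open>1 \<le> k\<close> \<open>k \<le> N\<close> by (intro power_increasing) auto
  then have "(q / 2) * (q ^ N / 2) \<le> (q - 1) * (q ^ N - 1)"
    using q by (intro mult_mono) auto
  then have "G1 * ((q / 2) * (q ^ N / 2)) \<le> G1 * ((q - 1) * (q ^ N - 1))"
    by (intro mult_left_mono) (auto simp: G1_def)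
  also note *
  also have "card S * (b * (q ^ k - 1)) \<le> card S * ((2 ^ n * q ^ m) * q ^ k)"
    using q b by (intro mult_left_mono mult_mono) (auto simp: b_def)
  finally have "G1 / card S \<le> 2 ^ (n + 2) * (q ^ (m + k) / q ^ (N + 1))"
    using G q by (simp add: divide_simps power_add mult_ac)
  moreover have "G0 / card S = 1 - G1 / card S"
    using sum G by (simp add: field_simps)
  ultimately show ?thesis
    using sym_density_eq[of d n k] assms(1) by (simp add: G0_def S_def)
qed

lemma sym_density_le_1: "sym_density R n k d \<le> 1"
proof -
  interpret V: finite_vectorspace R "sym_space R n"
    by (rule sym_space_finite_vectorspace)
  have "finite (subspaces_of_dim R (sym_space R n) k)"
    by (rule finite_subset[of _ "Pow (carrier (sym_space R n))"])
       (auto simp: subspaces_of_dim_def finite_sym_space dest: V.subspaceD(1))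
  then show ?thesis
    \<comment> \<open>If there is no subspace of dimension \<open>k\<close>, the quotient is 0
      because division by zero gives zero.\<close>
    unfolding sym_density_def by (intro divide_le_eq_1[THEN iffD2]) (auto intro!: card_mono simp: card_gt_0_iff)
qed

lemma sym_density_nonneg: "0 \<le> sym_density R n k d"
  by (simp add: sym_density_def)

end

section \<open>Asymptotics\<close>

text \<open>Closed form that links the counts with the exponents of the theorem, for
  \<open>r = n\<close> and \<open>r = d - 1\<close>.\<close>

lemma real_card_upper_pairs:
  assumes "r \<le> n"
  shows "real (card (upper_pairs n {..<r})) = real n * real r - real r * (real r - 1) / 2"
proof -
  have "2 * card (upper_pairs n {..<r}) + (n - r) * (n - r + 1) = n * (n + 1)"
    using card_upper_pairs[of "{..<r}" n] assms by (metis card_lessThan lessThan_subset_iff)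
  then have "real (2 * card (upper_pairs n {..<r}) + (n - r) * (n - r + 1)) = real (n * (n + 1))"
    by (rule arg_cong)
  then have "2 * real (card (upper_pairs n {..<r})) =
      real n * (real n + 1) - (real n - real r) * (real n - real r + 1)"
    using assms by (simp only: of_nat_add of_nat_mult of_nat_diff of_nat_numeral of_nat_1)
  also have "\<dots> = 2 * (real n * real r - real r * (real r - 1) / 2)"
    by (simp add: field_simps)
  finally show ?thesis by simp
qed

lemma eventually_at_top_primepow:
  assumes "\<And>q. primepow q \<Longrightarrow> P q"
  shows "\<forall>\<^sub>F q in at_top_primepow. P q"
  unfolding at_top_primepow_def eventually_inf_principal using assms by (intro always_eventually) auto

lemma tendsto_const_div_at_top_primepow: "((\<lambda>q. C / real q) \<longlongrightarrow> 0) at_top_primepow"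
proof (rule tendsto_mono)
  show "at_top_primepow \<le> at_top" by (simp add: at_top_primepow_def)
  show "((\<lambda>q. C / real q) \<longlongrightarrow> 0) at_top"
    by (rule lim_const_over_n)
qed

text \<open>Integer exponents differ by at least 1 once they differ, so a strict inequality already
  yields decay of order \<open>1 / q\<close>.\<close>

lemma power_ratio_le_inverse:
  fixes q :: real
  assumes "1 \<le> q" "a < b"
  shows "q ^ a / q ^ b \<le> 1 / q"
proof -
  have "q ^ Suc a \<le> q ^ b" using assms by (intro power_increasing) auto
  then show ?thesis using assms(1) by (simp add: divide_simps mult_ac)
qed

context
  fixes F :: "nat \<Rightarrow> 'a ring" and n k d N m :: nat
  assumes F: "\<And>q. primepow q \<Longrightarrow> field (F q) \<and> order (F q) = q"
    and d: "2 \<le> d" "d \<le> n" and k: "1 \<le> k" "k \<le> N"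
    and N: "N = card (upper_pairs n {..<n})" and m: "m = card (upper_pairs n {..<d - 1})"
begin

lemma finite_field_F:
  assumes "primepow q"
  shows "finite_field (F q)" "card (carrier (F q)) = q" "1 \<le> q"
proof -
  show "1 \<le> q" using primepow_gt_Suc_0[OF assms] by simp
  show card: "card (carrier (F q)) = q" using F[OF assms] by (simp add: order_def)
  \<comment> \<open>Infinite sets have cardinality 0, so positive order forces finiteness.\<close>
  have "finite (carrier (F q))"
    using card \<open>1 \<le> q\<close> by (intro card_ge_0_finite) simp
  then show "finite_field (F q)"
    using F[OF assms] by (simp add: finite_field_def finite_field_axioms_def)
qed

lemma sym_density_bigo:
  "(\<lambda>q. sym_density (F q) n k d) \<in> O[at_top_primepow](\<lambda>q. real q powr (real N + 1 - real m - real k))"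
proof (rule bigoI[of _ "2 ^ (m + 1)"], rule eventually_at_top_primepow)
  fix q :: nat assume q: "primepow q"
  note Fq = finite_field_F[OF q]
  interpret finite_field "F q" by (rule Fq)
  have "real q powr (real N + 1 - real m - real k) = real q powr (real (N + 1) - real (m + k))"
    by (simp add: algebra_simps)
  also have "\<dots> = real q powr real (N + 1) / real q powr real (m + k)"
    by (rule powr_diff)
  also have "\<dots> = real q ^ (N + 1) / real q ^ (m + k)"
    using Fq(3) by (subst (1 2) powr_realpow) auto
  finally show "norm (sym_density (F q) n k d)
      \<le> 2 ^ (m + 1) * norm (real q powr (real N + 1 - real m - real k))"
    using sym_density_le[OF d k(1) k(2)[unfolded N], folded N m, unfolded Fq(2)]
      sym_density_nonneg[of n k d] by simp
qed

lemma sym_density_tendsto_0: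
  assumes "N + 1 < m + k"
  shows "((\<lambda>q. sym_density (F q) n k d) \<longlongrightarrow> 0) at_top_primepow"
proof (rule tendsto_sandwich[OF _ _ tendsto_const tendsto_const_div_at_top_primepow];
    rule eventually_at_top_primepow)
  fix q :: nat assume q: "primepow q"
  note Fq = finite_field_F[OF q]
  interpret finite_field "F q" by (rule Fq)
  show "0 \<le> sym_density (F q) n k d" by (rule sym_density_nonneg)
  have "sym_density (F q) n k d \<le> 2 ^ (m + 1) * (real q ^ (N + 1) / real q ^ (m + k))"
    using sym_density_le[OF d k(1) k(2)[unfolded N], folded N m, unfolded Fq(2)] .
  also have "\<dots> \<le> 2 ^ (m + 1) * (1 / real q)"
    using assms Fq(3) by (intro mult_left_mono power_ratio_le_inverse) auto
  finally show "sym_density (F q) n k d \<le> 2 ^ (m + 1) / real q" by simp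
qed

lemma sym_density_tendsto_1:
  assumes "m + k < N + 1"
  shows "((\<lambda>q. sym_density (F q) n k d) \<longlongrightarrow> 1) at_top_primepow"
proof (rule tendsto_sandwich[OF _ _ _ tendsto_const])
  show "((\<lambda>q. 1 - 2 ^ (n + 2) / real q) \<longlongrightarrow> 1) at_top_primepow"
    using tendsto_diff[OF tendsto_const tendsto_const_div_at_top_primepow, of 1] by simp
  show "\<forall>\<^sub>F q in at_top_primepow. sym_density (F q) n k d \<le> 1"
    by (intro eventually_at_top_primepow finite_field.sym_density_le_1 finite_field_F)
  show "\<forall>\<^sub>F q in at_top_primepow. 1 - 2 ^ (n + 2) / real q \<le> sym_density (F q) n k d"
  proof (rule eventually_at_top_primepow)
    fix q :: nat assume q: "primepow q"
    note Fq = finite_field_F[OF q]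
    interpret finite_field "F q" by (rule Fq)
    have "2 ^ (n + 2) * (real q ^ (m + k) / real q ^ (N + 1)) \<le> 2 ^ (n + 2) * (1 / real q)"
      using assms Fq(3) by (intro mult_left_mono power_ratio_le_inverse) auto
    moreover have "1 - 2 ^ (n + 2) * (real q ^ (m + k) / real q ^ (N + 1)) \<le> sym_density (F q) n k d"
      using sym_density_ge[OF d k(1) k(2)[unfolded N], folded N m, unfolded Fq(2)] .
    ultimately show "1 - 2 ^ (n + 2) / real q \<le> sym_density (F q) n k d" by simp
  qed
qed

end

theorem theorem6p9:
  fixes F :: "nat \<Rightarrow> 'a ring" and n d k :: nat
  assumes F: "\<And>q. primepow q \<Longrightarrow> field (F q) \<and> order (F q) = q"
    and "2 \<le> n" and "2 \<le> d" and "d \<le> n" and "1 \<le> k"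
    and "even (n - d) \<Longrightarrow> real k \<le> real n * (real n - real d + 2) / 2"
    and "odd (n - d) \<Longrightarrow> real k \<le> (real n + 1) * (real n - real d + 1) / 2"
  shows "(\<lambda>q. sym_density (F q) n k d) \<in> O[at_top_primepow](\<lambda>q. real q powr
            (real n * (real n + 1) / 2 - real k + 1 - real n * (real d - 1)
              + (real d - 1) * (real d - 2) / 2)) \<and>
         (real k < real n * (real n + 1) / 2 + 1 - real n * (real d - 1)
              + (real d - 1) * (real d - 2) / 2 \<longrightarrow>
            ((\<lambda>q. sym_density (F q) n k d) \<longlongrightarrow> 1) at_top_primepow) \<and>
         (real k > real n * (real n + 1) / 2 + 1 - real n * (real d - 1)
              + (real d - 1) * (real d - 2) / 2 \<longrightarrow>
            ((\<lambda>q. sym_density (F q) n k d) \<longlongrightarrow> 0) at_top_primepow) \<and>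
         (\<lambda>q. sym_density (F q) n n n) \<in> O[at_top_primepow](\<lambda>q. real q powr (- real n + 2))"
proof -
  define N where "N = card (upper_pairs n {..<n})"
  \<comment> \<open>\<open>m\<close> stays a function of \<open>d\<close> because the last claim
    takes \<open>d = n\<close>.\<close>
  define m where "m d = card (upper_pairs n {..<d - 1})" for d
  have N: "real N = real n * (real n + 1) / 2"
    using real_card_upper_pairs[of n n] by (simp add: N_def field_simps)
  have m: "real (m d) = real n * (real d - 1) - (real d - 1) * (real d - 2) / 2"
    if "2 \<le> d" "d \<le> n" for d
    using real_card_upper_pairs[of "d - 1" n] that by (simp add: m_def of_nat_diff)
  \<comment> \<open>Because \<open>d \<ge> 2\<close>, either bound on \<open>k\<close> is at most
    the dimension \<open>n (n + 1) / 2\<close>, so \<open>k\<close>-dimensional subspaces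
    exist.\<close>
  have "real k \<le> real N"
  proof (cases "even (n - d)")
    case True
    have "real n * (real n - real d + 2) \<le> real n * (real n + 1)"
      using assms(3) by (intro mult_left_mono) auto
    then show ?thesis using assms(6)[OF True] N by simp
  next
    case False
    have "(real n - real d + 1) * (real n + 1) \<le> real n * (real n + 1)"
      using assms(3) by (intro mult_right_mono) auto
    then show ?thesis using assms(7)[OF False] N by (simp only: mult.commute)
  qed
  then have k: "k \<le> N" by simp
  have "real n * 2 \<le> real n * (real n + 1)"
    using assms(2) by (intro mult_left_mono) auto
  then have "real n \<le> real N" using N by simp
  then have n: "n \<le> N" by simp
  note args = F assms(3-5) k N_def m_def
  have e: "real n * (real n + 1) / 2 - real k + 1 - real n * (real d - 1)
      + (real d - 1) * (real d - 2) / 2 = real N + 1 - real (m d) - real k"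
    by (simp add: N m assms(3,4))
  have e': "real n * (real n + 1) / 2 + 1 - real n * (real d - 1)
      + (real d - 1) * (real d - 2) / 2 = real N + 1 - real (m d)"
    by (simp add: N m assms(3,4))
  \<comment> \<open>For \<open>d = n\<close> the exponent \<open>m n\<close> is
    \<open>N - 1\<close>, which leaves \<open>2 - n\<close> when \<open>k = n\<close>.\<close>
  have e'': "- real n + 2 = real N + 1 - real (m n) - real n"
    using N m[of n] assms(2) by (simp add: field_simps)
  show ?thesis
    unfolding e e' e''
  proof (intro conjI impI)
    show "(\<lambda>q. sym_density (F q) n k d) \<in>
        O[at_top_primepow](\<lambda>q. real q powr (real N + 1 - real (m d) - real k))"
      by (rule sym_density_bigo[OF args])
    show "(\<lambda>q. sym_density (F q) n n n) \<in>
        O[at_top_primepow](\<lambda>q. real q powr (real N + 1 - real (m n) - real n))"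
      using assms(2) n by (intro sym_density_bigo F N_def m_def) auto
    show "((\<lambda>q. sym_density (F q) n k d) \<longlongrightarrow> 1) at_top_primepow"
      if "real k < real N + 1 - real (m d)"
      using that by (intro sym_density_tendsto_1[OF args]) linarith+
    show "((\<lambda>q. sym_density (F q) n k d) \<longlongrightarrow> 0) at_top_primepow"
      if "real N + 1 - real (m d) < real k"
      using that by (intro sym_density_tendsto_0[OF args]) linarith+
  qed
qed

end
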